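(* Let $n\ge 1$, $2\le q\le 4$, $-n<p<0$, $M>0$ and $m>0$. Then, except for translation, the minimizer of $E$ on $\mathcal A$ is unique; that is, if $u,v\in\mathcal A$ are both minimizers of $E$ on $\mathcal A$, then there is $c\in\mathbb R^n$ such that $v(x)=u(x-c)$ for almost every $x\in\mathbb R^n$. In particular, the minimizer is, up to a translation, radially symmetric.
   Context: $\|x\|$ is the Euclidean norm on $\mathbb R^n$. The admissible set is $$\mathcal A=\Big\{u\in L^1(\mathbb R^n)\cap L^\infty(\mathbb R^n):\ u\ge 0,\ \|u\|_\infty\le M,\ \int_{\mathbb R^n}u(x)\,dx=m\Big\}.$$ The kernel is $K(x)=\frac{\|x\|^q}{q}-\frac{\|x\|^p}{p}$ (nonnegative, since $p<0<q$) and the functional is $$E(u)=\int_{\mathbb R^n\times\mathbb R^n}K(x-y)\,u(x)u(y)\,dx\,dy\in[0,\infty].$$ A minimizer of $E$ on $\mathcal A$ is a function $u\in\mathcal A$ with $E(u)<\infty$ and $E(u)\le E(w)$ for all $w\in\mathcal A$. A function $u$ is radially symmetric if $u(Cx)=u(x)$ (for a.e. $x$) for every orthogonal matrix $C$. Functions are identified when equal almost everywhere. *)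

theory Defs
  imports "HOL-Analysis.Analysis" "HOL-Probability.Essential_Supremum"
begin

text \<open>
  At the origin the library convention \<open>0 powr p = 0\<close> gives the value 0, whereas the
  attractive-repulsive kernel with \<open>p < 0\<close> is \<open>+\<infinity>\<close> there.  This has no effect on the energy below,
  since the diagonal is a null set of the product space.
\<close>

definition interaction_kernel :: "real \<Rightarrow> real \<Rightarrow> real ^ 'n \<Rightarrow> real" where
  "interaction_kernel p q x = norm x powr q / q - norm x powr p / p"

text \<open>
  Elements of \<open>L\<^sup>1 \<inter> L\<^sup>\<infinity>\<close> are represented by actual functions, so the pointwise bound is required
  almost everywhere.  Membership in \<open>L\<^sup>\<infinity>\<close> is contained in the bound on the essential supremum.
\<close>

definition admissible :: "real \<Rightarrow> real \<Rightarrow> (real ^ 'n \<Rightarrow> real) set" where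
  "admissible M m =
     {u. integrable lebesgue u
       \<and> (AE x in lebesgue. 0 \<le> u x)
       \<and> esssup lebesgue (\<lambda>x. ereal \<bar>u x\<bar>) \<le> ereal M
       \<and> integral\<^sup>L lebesgue u = m}"

text \<open>
  The integral is taken with respect to Lebesgue measure on the product space, the completion of
  the product measure; for Lebesgue measurable \<open>u\<close> the integrand is measurable for it.
  On \<open>admissible M m\<close>, and for \<open>p < 0 < q\<close>, the integrand is nonnegative almost everywhere,
  so the truncation in \<open>ennreal\<close> changes nothing.
\<close>

definition energy :: "real \<Rightarrow> real \<Rightarrow> (real ^ 'n \<Rightarrow> real) \<Rightarrow> ennreal" where
  "energy p q u =
     (\<integral>\<^sup>+ (x, y). ennreal (interaction_kernel p q (x - y) * u x * u y) \<partial>(lebesgue :: ((real ^ 'n) \<times> (real ^ 'n)) measure))"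

definition is_minimizer ::
  "real \<Rightarrow> real \<Rightarrow> real \<Rightarrow> real \<Rightarrow> (real ^ 'n \<Rightarrow> real) \<Rightarrow> bool" where
  "is_minimizer p q M m u \<longleftrightarrow>
     u \<in> admissible M m \<and> energy p q u < \<infinity>
     \<and> (\<forall>w \<in> (admissible M m :: (real ^ 'n \<Rightarrow> real) set). energy p q u \<le> energy p q w)"

definition radially_symmetric :: "(real ^ 'n \<Rightarrow> real) \<Rightarrow> bool" where
  "radially_symmetric u \<longleftrightarrow>
     (\<forall>C :: real ^ 'n ^ 'n. orthogonal_matrix C \<longrightarrow> (AE x in lebesgue. u (C *v x) = u x))"

end

theory Submission
  imports Defs "HOL-Probability.Distributions" "HOL-Real_Asymp.Real_Asymp"
begin

text \<open>
  On densities with the same mass and the same centre of mass the energy is strictly convex.  For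
  \<open>p < 0\<close> the power \<open>|z|\<^sup>p\<close> is a positive mixture of Gaussians \<open>exp (- t |z|\<^sup>2)\<close>, and each Gaussian is
  the convolution square of another one, so the interaction of \<open>f = u - v\<close> with itself is a mixture of
  squared norms of Gaussian transforms of \<open>f\<close>; these vanish only if \<open>f = 0\<close>.  For \<open>2 < q < 4\<close> the power
  \<open>|z|\<^sup>q\<close> is a positive mixture of \<open>exp (- t |z|\<^sup>2) - 1 + t |z|\<^sup>2\<close>, where the terms \<open>1\<close> and \<open>|z|\<^sup>2\<close>
  contribute nothing because \<open>f\<close> has vanishing mass and first moment; \<open>q = 4\<close> is the limit \<open>t \<rightarrow> 0\<close>.
  Two minimizers with the same centre therefore coincide, since otherwise their midpoint would have
  lower energy.  Orthogonal maps preserve a centre at the origin, which gives radial symmetry.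
\<close>

section \<open>Interaction integrals\<close>

text \<open>Gaussians take the place of the Fourier transform so that every integrand stays
  nonnegative and Tonelli exchanges all integrals without integrability conditions. The price is
  that nothing may be subtracted: each identity is arranged so that both sides are sums of
  nonnegative terms, and a term is cancelled only once it is known to be finite. The finite energy
  of a minimizer together with q >= 2 supplies a finite second moment, without which the centre of
  mass and the |z|^2 term would have no meaning. The range 2 < q < 4 is where the weight t^(-q/2-1)
  is integrable against the remainder of exp(-t), which has order t^2 at 0 and t at infinity. The
  attraction yields only a weak inequality; strictness comes from the repulsion, whose Gaussian
  defect has to vanish for almost every t > 0.\<close>

text \<open>
  The quadratic form at \<open>u - v\<close> may be a difference of infinite integrals, so everywhere below
  \<open>I(u,u) + I(v,v)\<close> is compared with \<open>2 I(u,v)\<close> in \<open>ennreal\<close> instead.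
\<close>

definition interaction ::
  "('a::euclidean_space \<Rightarrow> ennreal) \<Rightarrow> ('a \<Rightarrow> ennreal) \<Rightarrow> ('a \<Rightarrow> ennreal) \<Rightarrow> ennreal" where
  "interaction K u v = (\<integral>\<^sup>+x. \<integral>\<^sup>+y. K (x - y) * u x * v y \<partial>lborel \<partial>lborel)"

lemma interaction_add_kernel:
  assumes [measurable]: "K \<in> borel_measurable borel" "L \<in> borel_measurable borel"
    "u \<in> borel_measurable borel" "v \<in> borel_measurable borel"
  shows "interaction (\<lambda>z. K z + L z) u v = interaction K u v + interaction L u v"
  unfolding interaction_def
  by (simp add: nn_integral_add[symmetric] distrib_right)

lemma interaction_cmult_kernel:
  assumes [measurable]: "K \<in> borel_measurable borel"
    "u \<in> borel_measurable borel" "v \<in> borel_measurable borel"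
  shows "interaction (\<lambda>z. c * K z) u v = c * interaction K u v"
  unfolding interaction_def
  by (simp add: nn_integral_cmult[symmetric] mult.assoc)

lemma interaction_mono_kernel:
  assumes "\<And>z. K z \<le> L z"
  shows "interaction K u v \<le> interaction L u v"
  unfolding interaction_def by (intro nn_integral_mono mult_right_mono assms) auto

text \<open>For each x the point y = x is a null set, so the value of a kernel at the origin is
  immaterial. This absorbs the convention \<open>0 powr p = 0\<close>, for which the Gaussian
  mixture of a negative power fails at 0.\<close>

lemma interaction_cong_kernel:
  fixes K L :: "'a::euclidean_space \<Rightarrow> ennreal"
  assumes "\<And>z. z \<noteq> 0 \<Longrightarrow> K z = L z"
  shows "interaction K u v = interaction L u v"
  unfolding interaction_def
proof (rule nn_integral_cong)
  fix x :: 'a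
  show "(\<integral>\<^sup>+y. K (x - y) * u x * v y \<partial>lborel) = (\<integral>\<^sup>+y. L (x - y) * u x * v y \<partial>lborel)"
    using AE_lborel_singleton[of x] by (intro nn_integral_cong_AE) (auto simp: assms)
qed

lemma interaction_commute:
  assumes [measurable]: "K \<in> borel_measurable borel"
    "u \<in> borel_measurable borel" "v \<in> borel_measurable borel"
    and even: "\<And>z. K (- z) = K z"
  shows "interaction K u v = interaction K v u"
proof -
  have "interaction K u v = (\<integral>\<^sup>+y. \<integral>\<^sup>+x. K (x - y) * u x * v y \<partial>lborel \<partial>lborel)"
    unfolding interaction_def by (rule lborel_pair.Fubini'[symmetric]) simp
  also have "\<dots> = interaction K v u"
    unfolding interaction_def
    by (intro nn_integral_cong) (metis even minus_diff_eq mult.commute mult.left_commute)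
  finally show ?thesis .
qed

lemma interaction_add_left:
  assumes [measurable]: "K \<in> borel_measurable borel" "u \<in> borel_measurable borel"
    "u' \<in> borel_measurable borel" "v \<in> borel_measurable borel"
  shows "interaction K (\<lambda>x. u x + u' x) v = interaction K u v + interaction K u' v"
  unfolding interaction_def
  by (simp add: nn_integral_add[symmetric] distrib_right distrib_left)

lemma interaction_add_right:
  assumes [measurable]: "K \<in> borel_measurable borel" "u \<in> borel_measurable borel"
    "v \<in> borel_measurable borel" "v' \<in> borel_measurable borel"
  shows "interaction K u (\<lambda>x. v x + v' x) = interaction K u v + interaction K u v'"
  unfolding interaction_def
  by (simp add: nn_integral_add[symmetric] distrib_left)

lemma interaction_cmult_left:
  assumes [measurable]: "K \<in> borel_measurable borel"
    "u \<in> borel_measurable borel" "v \<in> borel_measurable borel"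
  shows "interaction K (\<lambda>x. c * u x) v = c * interaction K u v"
  unfolding interaction_def
  by (simp add: nn_integral_cmult[symmetric] ac_simps)

lemma interaction_cmult_right:
  assumes [measurable]: "K \<in> borel_measurable borel"
    "u \<in> borel_measurable borel" "v \<in> borel_measurable borel"
  shows "interaction K u (\<lambda>x. c * v x) = c * interaction K u v"
  unfolding interaction_def
  by (simp add: nn_integral_cmult[symmetric] ac_simps)

text \<open>Bilinear expansion; evenness of the kernel merges the two cross terms. The factor 4
  stands on the left so that no halves of extended values remain on the right.\<close>

lemma interaction_midpoint:
  assumes [measurable]: "K \<in> borel_measurable borel"
    "u \<in> borel_measurable borel" "v \<in> borel_measurable borel"
    and even: "\<And>z. K (- z) = K z"
  shows "4 * interaction K (\<lambda>x. (u x + v x) / 2) (\<lambda>x. (u x + v x) / 2) =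
    interaction K u u + 2 * interaction K u v + interaction K v v"
proof -
  let ?I = "interaction K (\<lambda>x. u x + v x) (\<lambda>x. u x + v x)"
  have eq: "(\<lambda>x. (u x + v x) / 2) = (\<lambda>x. (1/2) * (u x + v x))"
    by (simp add: ennreal_times_divide[symmetric] divide_ennreal_def mult.commute)
  have "4 * (inverse 2 * (inverse 2 * a)) = a" for a :: ennreal
  proof -
    have "4 * (inverse 2 * (inverse 2 * a)) = (2 * inverse 2) * (2 * inverse 2) * a"
      by (simp add: mult.assoc mult.left_commute)
    also have "2 * inverse 2 = (1 :: ennreal)"
      using ennreal_divide_self[of 2] by (simp add: divide_ennreal_def)
    finally show ?thesis by simp
  qed
  then have "4 * ((1/2) * ((1/2) * a)) = a" for a :: ennreal
    by (simp add: divide_ennreal_def)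
  then have "4 * interaction K (\<lambda>x. (u x + v x) / 2) (\<lambda>x. (u x + v x) / 2) = ?I"
    unfolding eq by (simp add: interaction_cmult_left interaction_cmult_right)
  also have "\<dots> = interaction K u u + 2 * interaction K u v + interaction K v v"
    using interaction_commute[of K u v]
    by (simp add: interaction_add_left interaction_add_right even algebra_simps mult_2)
  finally show ?thesis .
qed

text \<open>Two applications of Tonelli move the parameter integral outwards; no finiteness is
  involved, so both sides may be infinite.\<close>

lemma interaction_mixture:
  fixes k :: "real \<Rightarrow> 'a::euclidean_space \<Rightarrow> ennreal"
  assumes [measurable]: "(\<lambda>(t, z). k t z) \<in> borel_measurable (borel \<Otimes>\<^sub>M borel)"
    "w \<in> borel_measurable borel" "u \<in> borel_measurable borel" "v \<in> borel_measurable borel"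
  shows "interaction (\<lambda>z. \<integral>\<^sup>+t. w t * k t z \<partial>lborel) u v = (\<integral>\<^sup>+t. w t * interaction (k t) u v \<partial>lborel)"
proof -
  have "interaction (\<lambda>z. \<integral>\<^sup>+t. w t * k t z \<partial>lborel) u v =
    (\<integral>\<^sup>+x. \<integral>\<^sup>+y. \<integral>\<^sup>+t. w t * k t (x - y) * u x * v y \<partial>lborel \<partial>lborel \<partial>lborel)"
    unfolding interaction_def by (simp add: nn_integral_multc)
  also have "\<dots> = (\<integral>\<^sup>+x. \<integral>\<^sup>+t. \<integral>\<^sup>+y. w t * k t (x - y) * u x * v y \<partial>lborel \<partial>lborel \<partial>lborel)"
    by (intro nn_integral_cong lborel_pair.Fubini') simp
  also have "\<dots> = (\<integral>\<^sup>+t. \<integral>\<^sup>+x. \<integral>\<^sup>+y. w t * k t (x - y) * u x * v y \<partial>lborel \<partial>lborel \<partial>lborel)"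
    by (rule lborel_pair.Fubini') simp
  also have "\<dots> = (\<integral>\<^sup>+t. w t * interaction (k t) u v \<partial>lborel)"
    unfolding interaction_def by (simp add: nn_integral_cmult mult.assoc)
  finally show ?thesis .
qed

section \<open>Gaussian kernels and negative powers\<close>

definition gauss :: "real \<Rightarrow> 'a::euclidean_space \<Rightarrow> ennreal" where
  "gauss t z = ennreal (exp (- t * (norm z)\<^sup>2))"

lemma measurable_gauss [measurable]:
  assumes [measurable]: "f \<in> borel_measurable M" "g \<in> borel_measurable M"
  shows "(\<lambda>x. gauss (f x) (g x :: 'a::euclidean_space)) \<in> borel_measurable M"
  unfolding gauss_def by measurable

lemma measurable_interaction_gauss [measurable (raw)]:
  fixes u v :: "'a::euclidean_space \<Rightarrow> ennreal"
  assumes [measurable]: "f \<in> borel_measurable M" "u \<in> borel_measurable borel" "v \<in> borel_measurable borel"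
  shows "(\<lambda>x. interaction (gauss (f x)) u v) \<in> borel_measurable M"
  unfolding interaction_def by measurable

text \<open>The Gaussian integral (pi/t)^(n/2). The dimension enters only through the type, hence
  the \<open>itself\<close> argument.\<close>

definition gauss_mass :: "'a::euclidean_space itself \<Rightarrow> real \<Rightarrow> real" where
  "gauss_mass _ t = sqrt (pi / t) ^ DIM('a)"

lemma gauss_mass_pos: "t > 0 \<Longrightarrow> gauss_mass TYPE('a::euclidean_space) t > 0"
  by (simp add: gauss_mass_def)

lemma nn_integral_gauss_real:
  assumes t: "t > 0"
  shows "(\<integral>\<^sup>+x. ennreal (exp (- t * x\<^sup>2)) \<partial>lborel) = ennreal (sqrt (pi / t))"
proof -
  \<comment> \<open>A centred normal density of variance 1/(2 t) has exponent -t x^2 and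
    normalisation sqrt (pi / t).\<close>
  define s where "s = sqrt (1 / (2 * t))"
  have s: "s > 0" "s\<^sup>2 = 1 / (2 * t)" using t by (auto simp: s_def)
  have nd: "normal_density 0 s x = exp (- t * x\<^sup>2) / sqrt (pi / t)" for x
    using t by (simp add: normal_density_def s(2))
  have pos: "sqrt (pi / t) > 0" using t by simp
  have "(\<integral>\<^sup>+x. ennreal (normal_density 0 s x) \<partial>lborel) = 1"
    using s(1) by (subst nn_integral_eq_integral) (auto simp: normal_density_nonneg)
  then have "ennreal (sqrt (pi / t)) * (\<integral>\<^sup>+x. ennreal (normal_density 0 s x) \<partial>lborel) = ennreal (sqrt (pi / t))"
    by simp
  also have "ennreal (sqrt (pi / t)) * (\<integral>\<^sup>+x. ennreal (normal_density 0 s x) \<partial>lborel) =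
     (\<integral>\<^sup>+x. ennreal (sqrt (pi / t)) * ennreal (normal_density 0 s x) \<partial>lborel)"
    by (subst nn_integral_cmult) auto
  also have "\<dots> = (\<integral>\<^sup>+x. ennreal (exp (- t * x\<^sup>2)) \<partial>lborel)"
    using pos t by (intro nn_integral_cong) (simp add: nd ennreal_mult'[symmetric] less_imp_le)
  finally show ?thesis .
qed

lemma nn_integral_gauss:
  assumes t: "t > 0"
  shows "(\<integral>\<^sup>+z. gauss t (z :: 'a::euclidean_space) \<partial>lborel) = ennreal (gauss_mass TYPE('a) t)"
proof -
  have "gauss t z = (\<Prod>b\<in>Basis. ennreal (exp (- t * (z \<bullet> b)\<^sup>2)))" for z :: 'a
  proof -
    have "(norm z)\<^sup>2 = (\<Sum>b\<in>Basis. (z \<bullet> b)\<^sup>2)"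
      unfolding power2_norm_eq_inner by (subst euclidean_inner) (simp add: power2_eq_square)
    then show ?thesis
      by (simp add: gauss_def prod_ennreal exp_sum[symmetric] sum_distrib_left sum_negf)
  qed
  then have "(\<integral>\<^sup>+z. gauss t (z :: 'a) \<partial>lborel) =
    (\<integral>\<^sup>+z. (\<Prod>b\<in>(Basis :: 'a set). ennreal (exp (- t * (z \<bullet> b)\<^sup>2))) \<partial>lborel)"
    by simp
  also have "\<dots> = (\<Prod>b\<in>(Basis :: 'a set). \<integral>\<^sup>+x. ennreal (exp (- t * x\<^sup>2)) \<partial>lborel)"
    by (rule nn_integral_lborel_prod) auto
  also have "\<dots> = ennreal (gauss_mass TYPE('a) t)"
    unfolding nn_integral_gauss_real[OF t] using t by (simp add: gauss_mass_def ennreal_power)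
  finally show ?thesis .
qed

lemma nn_integral_lborel_translate:
  fixes f :: "'a::euclidean_space \<Rightarrow> ennreal"
  assumes [measurable]: "f \<in> borel_measurable borel"
  shows "(\<integral>\<^sup>+x. f (x - c) \<partial>lborel) = (\<integral>\<^sup>+x. f x \<partial>lborel)"
proof -
  have "(\<integral>\<^sup>+x. f x \<partial>lborel) = (\<integral>\<^sup>+x. f x \<partial>distr lborel borel ((+) (- c)))"
    by (simp add: lborel_distr_plus)
  also have "\<dots> = (\<integral>\<^sup>+x. f (x - c) \<partial>lborel)"
    by (subst nn_integral_distr) auto
  finally show ?thesis by simp
qed

section \<open>Gaussian transforms and the interaction as a squared norm\<close>

definition gauss_transform :: "real \<Rightarrow> ('a::euclidean_space \<Rightarrow> ennreal) \<Rightarrow> 'a \<Rightarrow> ennreal" where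
  "gauss_transform t u z = (\<integral>\<^sup>+x. gauss t (x - z) * u x \<partial>lborel)"

lemma measurable_gauss_transform [measurable (raw)]:
  fixes u :: "'a::euclidean_space \<Rightarrow> ennreal"
  assumes [measurable]: "u \<in> borel_measurable borel" "f \<in> borel_measurable M" "g \<in> borel_measurable M"
  shows "(\<lambda>x. gauss_transform (f x) u (g x)) \<in> borel_measurable M"
  unfolding gauss_transform_def by measurable

text \<open>Completing the square in z about the midpoint of x and y. All dependence on z then sits
  in one Gaussian whose integral is independent of x and y, which explains the parameters 2 t and 4
  t.\<close>

lemma gauss_mult_gauss:
  fixes x y z :: "'a::euclidean_space"
  shows "gauss (2 * t) (x - z) * gauss (2 * t) (y - z) =
    gauss t (x - y) * gauss (4 * t) (z - (x + y) /\<^sub>R 2)"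
proof -
  have "2 * t * (norm (x - z))\<^sup>2 + 2 * t * (norm (y - z))\<^sup>2 =
    t * (norm (x - y))\<^sup>2 + 4 * t * (norm (z - (x + y) /\<^sub>R 2))\<^sup>2"
    unfolding power2_norm_eq_inner by (simp add: inner_simps inner_commute algebra_simps)
  then have "- (2 * t) * (norm (x - z))\<^sup>2 + - (2 * t) * (norm (y - z))\<^sup>2 =
    - t * (norm (x - y))\<^sup>2 + - (4 * t) * (norm (z - (x + y) /\<^sub>R 2))\<^sup>2"
    by linarith
  then show ?thesis
    unfolding gauss_def by (simp only: ennreal_mult'[symmetric] exp_ge_zero exp_add[symmetric])
qed

text \<open>After Tonelli, the z-integral of \<open>gauss_mult_gauss\<close> leaves
  \<open>gauss t (x - y)\<close> times the mass of the midpoint Gaussian. For u = v the right side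
  is a squared L2 norm, which expresses positive definiteness of the kernel.\<close>

lemma interaction_gauss:
  fixes u v :: "'a::euclidean_space \<Rightarrow> ennreal"
  assumes t: "t > 0" and [measurable]: "u \<in> borel_measurable borel" "v \<in> borel_measurable borel"
  shows "gauss_mass TYPE('a) (4 * t) * interaction (gauss t) u v =
    (\<integral>\<^sup>+z. gauss_transform (2 * t) u z * gauss_transform (2 * t) v z \<partial>lborel)"
proof -
  let ?g = "\<lambda>x y z. gauss (2 * t) (x - z) * gauss (2 * t) (y - z)"
  have "(\<integral>\<^sup>+z. gauss_transform (2 * t) u z * gauss_transform (2 * t) v z \<partial>lborel) =
    (\<integral>\<^sup>+z. \<integral>\<^sup>+x. \<integral>\<^sup>+y. ?g x y z * u x * v y \<partial>lborel \<partial>lborel \<partial>lborel)"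
  proof (rule nn_integral_cong)
    fix z :: 'a
    have "gauss_transform (2 * t) u z * gauss_transform (2 * t) v z =
      (\<integral>\<^sup>+x. \<integral>\<^sup>+y. (gauss (2 * t) (x - z) * u x) * (gauss (2 * t) (y - z) * v y) \<partial>lborel \<partial>lborel)"
      unfolding gauss_transform_def by (simp add: nn_integral_multc nn_integral_cmult)
    then show "gauss_transform (2 * t) u z * gauss_transform (2 * t) v z =
      (\<integral>\<^sup>+x. \<integral>\<^sup>+y. ?g x y z * u x * v y \<partial>lborel \<partial>lborel)"
      by (simp add: ac_simps)
  qed
  also have "\<dots> = (\<integral>\<^sup>+x. \<integral>\<^sup>+z. \<integral>\<^sup>+y. ?g x y z * u x * v y \<partial>lborel \<partial>lborel \<partial>lborel)"
    by (rule lborel_pair.Fubini') simp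
  also have "\<dots> = (\<integral>\<^sup>+x. \<integral>\<^sup>+y. \<integral>\<^sup>+z. ?g x y z * u x * v y \<partial>lborel \<partial>lborel \<partial>lborel)"
    by (intro nn_integral_cong lborel_pair.Fubini') simp
  also have "\<dots> = (\<integral>\<^sup>+x. \<integral>\<^sup>+y. gauss_mass TYPE('a) (4 * t) * (gauss t (x - y) * u x * v y) \<partial>lborel \<partial>lborel)"
  proof (rule nn_integral_cong, rule nn_integral_cong)
    fix x y :: 'a
    have "(\<integral>\<^sup>+z. ?g x y z * u x * v y \<partial>lborel) =
      (\<integral>\<^sup>+z. (gauss t (x - y) * u x * v y) * gauss (4 * t) (z - (x + y) /\<^sub>R 2) \<partial>lborel)"
      unfolding gauss_mult_gauss by (simp only: ac_simps)
    also have "\<dots> = (gauss t (x - y) * u x * v y) * gauss_mass TYPE('a) (4 * t)"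
      using t by (simp add: nn_integral_cmult nn_integral_lborel_translate[of "gauss (4 * t)"] nn_integral_gauss)
    finally show "(\<integral>\<^sup>+z. ?g x y z * u x * v y \<partial>lborel) =
      gauss_mass TYPE('a) (4 * t) * (gauss t (x - y) * u x * v y)"
      by (simp add: ac_simps)
  qed
  also have "\<dots> = gauss_mass TYPE('a) (4 * t) * interaction (gauss t) u v"
    unfolding interaction_def by (simp add: nn_integral_cmult)
  finally show ?thesis by simp
qed

text \<open>For finite arguments truncated subtraction makes one summand 0, so this is |a - b|. If
  an argument is infinite the value is \<open>top\<close>, even for a = b = \<open>top\<close>, so
  the identity for sums of squares has no side condition.\<close>

definition ennreal_dist :: "ennreal \<Rightarrow> ennreal \<Rightarrow> ennreal" where
  "ennreal_dist a b = (a - b) + (b - a)"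

lemma ennreal_dist_eq_0_D: "ennreal_dist a b = 0 \<Longrightarrow> a = b"
  unfolding ennreal_dist_def
  by (cases a; cases b) (auto simp: ennreal_minus_if split: if_splits)

lemma measurable_ennreal_dist [measurable (raw)]:
  assumes [measurable]: "f \<in> borel_measurable M" "g \<in> borel_measurable M"
  shows "(\<lambda>x. ennreal_dist (f x) (g x)) \<in> borel_measurable M"
  unfolding ennreal_dist_def by measurable

text \<open>The binomial formula for (a - b)^2 in a form free of subtraction, hence valid for
  infinite values too.\<close>

lemma ennreal_sum_squares:
  "a * a + b * b = 2 * (a * b) + (ennreal_dist a b)\<^sup>2"
proof (cases a; cases b)
  fix r s assume ab: "a = ennreal r" "0 \<le> r" "b = ennreal s" "0 \<le> s"
  have "ennreal_dist a b = ennreal \<bar>r - s\<bar>"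
    using ab by (auto simp: ennreal_dist_def ennreal_minus_if)
  moreover have "r * r + s * s = 2 * (r * s) + \<bar>r - s\<bar>\<^sup>2"
    by (simp add: power2_eq_square algebra_simps)
  ultimately have "ennreal (r * r + s * s) = ennreal (2 * (r * s)) + (ennreal_dist a b)\<^sup>2"
    using ab by (simp add: ennreal_power del: ennreal_plus) (simp add: ennreal_plus[symmetric] del: ennreal_plus)
  then show ?thesis
    using ab by (simp add: ennreal_mult)
qed (auto simp: ennreal_dist_def ennreal_top_mult ennreal_mult_top power2_eq_square)

text \<open>Division by the mass makes this the Gaussian interaction of u - v with itself, expressed
  through the difference of the transforms so that no signed density appears.\<close>

definition gauss_discrepancy ::
  "real \<Rightarrow> ('a::euclidean_space \<Rightarrow> ennreal) \<Rightarrow> ('a \<Rightarrow> ennreal) \<Rightarrow> ennreal" where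
  "gauss_discrepancy t u v =
    (\<integral>\<^sup>+z. (ennreal_dist (gauss_transform (2 * t) u z) (gauss_transform (2 * t) v z))\<^sup>2 \<partial>lborel) /
    gauss_mass TYPE('a) (4 * t)"

lemma measurable_gauss_discrepancy [measurable]:
  fixes u v :: "'a::euclidean_space \<Rightarrow> ennreal"
  assumes [measurable]: "u \<in> borel_measurable borel" "v \<in> borel_measurable borel"
  shows "(\<lambda>t. gauss_discrepancy t u v) \<in> borel_measurable borel"
  unfolding gauss_discrepancy_def gauss_mass_def by measurable

text \<open>Integrate \<open>ennreal_sum_squares\<close> for the two transforms; the mass is
  positive and finite and therefore cancels.\<close>

lemma interaction_gauss_identity:
  fixes u v :: "'a::euclidean_space \<Rightarrow> ennreal"
  assumes t: "t > 0" and [measurable]: "u \<in> borel_measurable borel" "v \<in> borel_measurable borel"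
  shows "interaction (gauss t) u u + interaction (gauss t) v v =
    2 * interaction (gauss t) u v + gauss_discrepancy t u v"
proof -
  define A where "A = ennreal (gauss_mass TYPE('a) (4 * t))"
  let ?U = "gauss_transform (2 * t) u" and ?V = "gauss_transform (2 * t) v"
  have "gauss_mass TYPE('a) (4 * t) > 0"
    using t by (intro gauss_mass_pos) simp
  then have A: "A \<noteq> 0" "A \<noteq> top" by (auto simp: A_def)
  have "A * (interaction (gauss t) u u + interaction (gauss t) v v) =
    (\<integral>\<^sup>+z. ?U z * ?U z + ?V z * ?V z \<partial>lborel)"
    using interaction_gauss[OF t, of u u] interaction_gauss[OF t, of v v]
    by (simp add: nn_integral_add A_def distrib_left)
  also have "\<dots> = 2 * (\<integral>\<^sup>+z. ?U z * ?V z \<partial>lborel) + (\<integral>\<^sup>+z. (ennreal_dist (?U z) (?V z))\<^sup>2 \<partial>lborel)"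
    by (simp add: ennreal_sum_squares nn_integral_add nn_integral_cmult)
  also have "(\<integral>\<^sup>+z. ?U z * ?V z \<partial>lborel) = A * interaction (gauss t) u v"
    using interaction_gauss[OF t, of u v] by (simp add: A_def)
  also have "(\<integral>\<^sup>+z. (ennreal_dist (?U z) (?V z))\<^sup>2 \<partial>lborel) = A * gauss_discrepancy t u v"
    unfolding gauss_discrepancy_def A_def[symmetric]
    using A by (simp add: ennreal_times_divide mult.commute[of A] ennreal_mult_divide_eq)
  finally have "A * (interaction (gauss t) u u + interaction (gauss t) v v) =
    A * (2 * interaction (gauss t) u v + gauss_discrepancy t u v)"
    by (simp add: distrib_left mult.left_commute)
  then show ?thesis using A by (simp add: ennreal_mult_cancel_left)
qed

text \<open>The substitution t -> |z|^2 t in Euler's integral for Gamma(-p/2). At z = 0 the right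
  side diverges while \<open>powr\<close> gives 0, whence the exclusion of the origin.\<close>

lemma Gamma_powr_eq_gauss_mixture:
  fixes z :: "'a::euclidean_space"
  assumes p: "p < 0" and z: "z \<noteq> 0"
  shows "ennreal (Gamma (- p / 2)) * ennreal (norm z powr p) =
    (\<integral>\<^sup>+t. ennreal (indicator {0..} t * t powr (- p / 2 - 1)) * gauss t z \<partial>lborel)"
proof -
  define r where "r = norm z"
  have r: "r > 0" using z by (simp add: r_def)
  have "ennreal (Gamma (- p / 2)) =
    (\<integral>\<^sup>+t. ennreal (indicator {0..} t * t powr (- p / 2 - 1) / exp t) \<partial>lborel)"
    using p by (intro Gamma_conv_nn_integral_real) simp
  also have "\<dots> = ennreal \<bar>r\<^sup>2\<bar> * (\<integral>\<^sup>+t. ennreal (indicator {0..} (0 + r\<^sup>2 * t) *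
      (0 + r\<^sup>2 * t) powr (- p / 2 - 1) / exp (0 + r\<^sup>2 * t)) \<partial>lborel)"
    using r by (intro nn_integral_real_affine) auto
  also have "\<dots> = (\<integral>\<^sup>+t. ennreal (r powr (- p)) * (ennreal (indicator {0..} t * t powr (- p / 2 - 1)) * gauss t z) \<partial>lborel)"
  proof (subst nn_integral_cmult[symmetric], simp, rule nn_integral_cong)
    fix t :: real
    have "\<bar>r\<^sup>2\<bar> * (indicator {0..} (0 + r\<^sup>2 * t) * (0 + r\<^sup>2 * t) powr (- p / 2 - 1) / exp (0 + r\<^sup>2 * t)) =
      r powr (- p) * (indicator {0..} t * t powr (- p / 2 - 1) * exp (- t * r\<^sup>2))"
    proof (cases "t \<ge> 0")
      case True
      have ind: "indicator {0..} (0 + r\<^sup>2 * t) = (1 :: real)" "indicator {0..} t = (1 :: real)"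
        using True by auto
      have "r\<^sup>2 * (r\<^sup>2 * t) powr (- p / 2 - 1) = r powr 2 * ((r powr 2) powr (- p / 2 - 1) * t powr (- p / 2 - 1))"
        using r True by (simp add: powr_mult powr_numeral)
      also have "\<dots> = (r powr 2 * r powr (- p - 2)) * t powr (- p / 2 - 1)"
        by (simp add: powr_powr right_diff_distrib)
      also have "r powr 2 * r powr (- p - 2) = r powr (- p)"
        by (simp only: powr_add[symmetric]) simp
      finally have E: "r\<^sup>2 * (r\<^sup>2 * t) powr (- p / 2 - 1) = r powr (- p) * t powr (- p / 2 - 1)" .
      have X: "exp (- t * r\<^sup>2) = inverse (exp (r\<^sup>2 * t))"
        by (metis exp_minus mult_minus_left mult.commute)
      have "\<bar>r\<^sup>2\<bar> * (1 * (0 + r\<^sup>2 * t) powr (- p / 2 - 1) / exp (0 + r\<^sup>2 * t)) =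
        (r\<^sup>2 * (r\<^sup>2 * t) powr (- p / 2 - 1)) / exp (r\<^sup>2 * t)"
        by simp
      also have "\<dots> = r powr (- p) * (1 * t powr (- p / 2 - 1) * exp (- t * r\<^sup>2))"
        unfolding E X by (simp only: divide_inverse mult_1 mult.assoc)
      finally show ?thesis unfolding ind .
    next
      case False
      then have "r\<^sup>2 * t < 0" using r by (simp add: mult_pos_neg)
      then show ?thesis using False by simp
    qed
    then show "ennreal \<bar>r\<^sup>2\<bar> * ennreal (indicator {0..} (0 + r\<^sup>2 * t) * (0 + r\<^sup>2 * t) powr (- p / 2 - 1) / exp (0 + r\<^sup>2 * t)) =
      ennreal (r powr (- p)) * (ennreal (indicator {0..} t * t powr (- p / 2 - 1)) * gauss t z)"
      unfolding gauss_def r_def[symmetric] by (simp only: ennreal_mult'[symmetric] abs_ge_zero powr_ge_zero mult_nonneg_nonneg indicator_pos_le exp_ge_zero)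
  qed
  also have "\<dots> = ennreal (r powr (- p)) * (\<integral>\<^sup>+t. ennreal (indicator {0..} t * t powr (- p / 2 - 1)) * gauss t z \<partial>lborel)"
    by (rule nn_integral_cmult) simp
  finally have "ennreal (Gamma (- p / 2)) * ennreal (r powr p) = ennreal (r powr p) * ennreal (r powr (- p)) *
      (\<integral>\<^sup>+t. ennreal (indicator {0..} t * t powr (- p / 2 - 1)) * gauss t z \<partial>lborel)"
    by (simp add: ac_simps)
  also have "ennreal (r powr p) * ennreal (r powr (- p)) = 1"
    using r by (simp add: ennreal_mult'[symmetric] powr_add[symmetric])
  finally show ?thesis by (simp add: r_def)
qed

text \<open>The Gaussian identity integrated against the weight of the mixture, with the Gamma
  factor kept as a multiplier. The last integral is the defect whose vanishing forces u = v.\<close>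

lemma interaction_negative_power_identity:
  fixes u v :: "'a::euclidean_space \<Rightarrow> ennreal"
  assumes p: "p < 0" and [measurable]: "u \<in> borel_measurable borel" "v \<in> borel_measurable borel"
  defines "K \<equiv> \<lambda>z. ennreal (norm z powr p)"
  shows "ennreal (Gamma (- p / 2)) * (interaction K u u + interaction K v v) =
    ennreal (Gamma (- p / 2)) * (2 * interaction K u v) +
    (\<integral>\<^sup>+t. ennreal (indicator {0..} t * t powr (- p / 2 - 1)) * gauss_discrepancy t u v \<partial>lborel)"
proof -
  define w where "w = (\<lambda>t. ennreal (indicator {0..} t * t powr (- p / 2 - 1)))"
  define G where "G = ennreal (Gamma (- p / 2))"
  have [measurable]: "w \<in> borel_measurable borel" unfolding w_def by measurable
  have *: "G * interaction K u v = (\<integral>\<^sup>+t. w t * interaction (gauss t) u v \<partial>lborel)"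
    if [measurable]: "u \<in> borel_measurable borel" "v \<in> borel_measurable borel" for u v :: "'a \<Rightarrow> ennreal"
  proof -
    have "G * interaction K u v = interaction (\<lambda>z. G * K z) u v"
      by (simp add: interaction_cmult_kernel K_def)
    also have "\<dots> = interaction (\<lambda>z. \<integral>\<^sup>+t. w t * gauss t z \<partial>lborel) u v"
      unfolding K_def G_def w_def using p by (intro interaction_cong_kernel Gamma_powr_eq_gauss_mixture)
    also have "\<dots> = (\<integral>\<^sup>+t. w t * interaction (gauss t) u v \<partial>lborel)"
      by (rule interaction_mixture) auto
    finally show ?thesis .
  qed
  have "G * (interaction K u u + interaction K v v) =
    (\<integral>\<^sup>+t. w t * (interaction (gauss t) u u + interaction (gauss t) v v) \<partial>lborel)"
    by (simp add: * distrib_left nn_integral_add)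
  also have "\<dots> = (\<integral>\<^sup>+t. 2 * (w t * interaction (gauss t) u v) + w t * gauss_discrepancy t u v \<partial>lborel)"
  \<comment> \<open>For t > 0 the Gaussian identity applies, for t < 0 the weight is 0, and t = 0 is
    a null set.\<close>
  proof (rule nn_integral_cong_AE, use AE_lborel_singleton[of "0::real"] in eventually_elim)
    fix t :: real assume "t \<noteq> 0"
    then show "w t * (interaction (gauss t) u u + interaction (gauss t) v v) =
      2 * (w t * interaction (gauss t) u v) + w t * gauss_discrepancy t u v"
      by (cases "t > 0") (auto simp: interaction_gauss_identity distrib_left ac_simps w_def)
  qed
  also have "\<dots> = 2 * (G * interaction K u v) +
    (\<integral>\<^sup>+t. w t * gauss_discrepancy t u v \<partial>lborel)"
    by (simp add: * nn_integral_add nn_integral_cmult)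
  finally show ?thesis unfolding w_def G_def by (simp only: ac_simps)
qed

section \<open>Powers between two and four\<close>

text \<open>exp(-s) minus its Taylor polynomial of degree one: the order s^2 at 0 tames the weight
  t^(-q/2-1) there.\<close>

definition exp_remainder :: "real \<Rightarrow> real" where
  "exp_remainder s = exp (- s) - 1 + s"

lemma exp_remainder_nonneg: "exp_remainder s \<ge> 0"
  using exp_ge_add_one_self[of "- s"] by (simp add: exp_remainder_def)

lemma exp_remainder_le_self: "s \<ge> 0 \<Longrightarrow> exp_remainder s \<le> s"
  by (simp add: exp_remainder_def)

text \<open>The derivative of s^2/2 minus the remainder is the remainder itself, hence
  nonnegative.\<close>

lemma exp_remainder_le_square:
  assumes "s \<ge> 0"
  shows "exp_remainder s \<le> s\<^sup>2 / 2"
proof -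
  have "0\<^sup>2 / 2 - exp_remainder 0 \<le> s\<^sup>2 / 2 - exp_remainder s"
  proof (rule DERIV_nonneg_imp_nondecreasing[OF assms], intro exI conjI)
    fix x :: real
    show "((\<lambda>s. s\<^sup>2 / 2 - exp_remainder s) has_real_derivative (x - (1 - exp (- x)))) (at x)"
      unfolding exp_remainder_def by (auto intro!: derivative_eq_intros)
    show "0 \<le> x - (1 - exp (- x))"
      using exp_remainder_nonneg[of x] by (simp add: exp_remainder_def)
  qed
  then show ?thesis by (simp add: exp_remainder_def)
qed

text \<open>Squaring 1 - s/2 <= exp(-s/2) gains s^2/4 over the linear bound; squaring is monotone
  because 1 - s/2 is nonnegative in this range.\<close>

lemma exp_remainder_pos:
  assumes "0 < s" "s < 1"
  shows "exp_remainder s > 0"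
proof -
  have "(1 + - s / 2)\<^sup>2 \<le> (exp (- s / 2))\<^sup>2"
    using assms exp_ge_add_one_self[of "- s / 2"] by (intro power_mono) auto
  also have "\<dots> = exp (- s)" by (simp add: power2_eq_square exp_add[symmetric])
  finally have "exp (- s) \<ge> 1 - s + s\<^sup>2 / 4" by (simp add: power2_eq_square field_simps)
  moreover have "s\<^sup>2 / 4 > 0" using assms by simp
  ultimately show ?thesis unfolding exp_remainder_def by linarith
qed

lemma measurable_exp_remainder [measurable (raw)]:
  assumes [measurable]: "f \<in> borel_measurable M"
  shows "(\<lambda>x. exp_remainder (f x)) \<in> borel_measurable M"
  unfolding exp_remainder_def by measurable

text \<open>For 2 < q < 4 this is Gamma(-q/2) by the Cauchy-Saalschuetz formula; only positivity and
  finiteness of the constant enter.\<close>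

definition remainder_mass :: "real \<Rightarrow> ennreal" where
  "remainder_mass q = (\<integral>\<^sup>+t. ennreal (indicator {0..} t * t powr (- q / 2 - 1) * exp_remainder t) \<partial>lborel)"

lemma remainder_mass_pos: "remainder_mass q \<noteq> 0"
proof
  assume "remainder_mass q = 0"
  then have "AE t in lborel. ennreal (indicator {0..} t * t powr (- q / 2 - 1) * exp_remainder t) = 0"
    unfolding remainder_mass_def by (subst (asm) nn_integral_0_iff_AE) auto
  then have "AE t in lborel. t \<notin> {0<..<1::real}"
  proof eventually_elim
    case (elim t)
    show ?case
    proof
      assume t: "t \<in> {0<..<1}"
      then have "indicator {0..} t * t powr (- q / 2 - 1) * exp_remainder t > 0"
        using exp_remainder_pos[of t] by simp
      with elim show False by auto
    qed
  qed
  then have "{0<..<1::real} \<in> null_sets lborel"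
    by (subst (asm) AE_iff_null_sets[symmetric]) auto
  then show False by (auto simp: null_sets_def)
qed

text \<open>Near 0 the quadratic bound leaves t^(1-q/2), integrable because q < 4; beyond 1 the
  linear bound leaves t^(-q/2), integrable because q > 2.\<close>

lemma remainder_mass_finite:
  assumes q: "2 < q" "q < 4"
  shows "remainder_mass q < top"
proof -
  have 1: "(\<integral>\<^sup>+t. ennreal (t powr (1 - q / 2)) * indicator {0..1} t \<partial>lborel) < top"
    using nn_integral_has_integral_lebesgue[OF _ has_integral_powr_from_0[of "1 - q / 2" 1]] q
    by (simp add: ennreal_mult' ennreal_indicator mult.commute)
  have 2: "(\<integral>\<^sup>+t. ennreal (t powr (- q / 2)) * indicator {1..} t \<partial>lborel) < top"
    using nn_integral_has_integral_lebesgue[OF _ has_integral_powr_to_inf[of "- q / 2" 1]] q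
    by (simp add: ennreal_mult' ennreal_indicator mult.commute)
  have "remainder_mass q \<le> (\<integral>\<^sup>+t. ennreal (t powr (1 - q / 2)) * indicator {0..1} t +
      ennreal (t powr (- q / 2)) * indicator {1..} t \<partial>lborel)"
    unfolding remainder_mass_def
  proof (rule nn_integral_mono)
    fix t :: real
    consider "t \<le> 0" | "0 < t" "t \<le> 1" | "1 < t" by linarith
    then show "ennreal (indicator {0..} t * t powr (- q / 2 - 1) * exp_remainder t) \<le>
      ennreal (t powr (1 - q / 2)) * indicator {0..1} t + ennreal (t powr (- q / 2)) * indicator {1..} t"
    proof cases
      case 2
      have "exp_remainder t \<le> t\<^sup>2 / 2"
        using 2 by (intro exp_remainder_le_square) simp
      also have "\<dots> \<le> t powr 2"
        using 2 by (simp add: powr_numeral)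
      finally have "exp_remainder t \<le> t powr 2" .
      then have "t powr (- q / 2 - 1) * exp_remainder t \<le> t powr (- q / 2 - 1) * t powr 2"
        by (intro mult_left_mono) auto
      also have "\<dots> = t powr (1 - q / 2)"
        by (simp only: powr_add[symmetric]) (simp add: algebra_simps)
      finally have "ennreal (t powr (- q / 2 - 1) * exp_remainder t) \<le> ennreal (t powr (1 - q / 2))"
        by (rule ennreal_leI)
      then show ?thesis using 2 by (intro add_increasing2) auto
    next
      case 3
      have "t powr (- q / 2 - 1) * exp_remainder t \<le> t powr (- q / 2 - 1) * t powr 1"
        using exp_remainder_le_self[of t] 3 by (intro mult_left_mono) auto
      also have "\<dots> = t powr (- q / 2)"
        by (simp only: powr_add[symmetric]) simp
      finally have "ennreal (t powr (- q / 2 - 1) * exp_remainder t) \<le> ennreal (t powr (- q / 2))"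
        by (rule ennreal_leI)
      then show ?thesis using 3 by (auto simp: indicator_def)
    qed (auto simp: indicator_def)
  qed
  also have "\<dots> < top"
    using 1 2 by (subst nn_integral_add) auto
  finally show ?thesis .
qed

text \<open>The scaling t -> |z|^2 t, as for the Gamma integral, with the remainder in place of the
  exponential.\<close>

lemma remainder_mass_powr:
  fixes z :: "'a::euclidean_space"
  assumes z: "z \<noteq> 0"
  shows "remainder_mass q * ennreal (norm z powr q) =
    (\<integral>\<^sup>+t. ennreal (indicator {0..} t * t powr (- q / 2 - 1)) * ennreal (exp_remainder (t * (norm z)\<^sup>2)) \<partial>lborel)"
proof -
  define r where "r = norm z"
  define e where "e = - q / 2 - 1"
  have r: "r > 0" using z by (simp add: r_def)
  have "remainder_mass q = ennreal \<bar>r\<^sup>2\<bar> * (\<integral>\<^sup>+t. ennreal (indicator {0..} (0 + r\<^sup>2 * t) *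
      (0 + r\<^sup>2 * t) powr e * exp_remainder (0 + r\<^sup>2 * t)) \<partial>lborel)"
    unfolding remainder_mass_def e_def using r by (intro nn_integral_real_affine) auto
  also have "\<dots> = (\<integral>\<^sup>+t. ennreal (r powr (- q)) * (ennreal (indicator {0..} t * t powr e) * ennreal (exp_remainder (t * r\<^sup>2))) \<partial>lborel)"
  proof (subst nn_integral_cmult[symmetric], simp, rule nn_integral_cong)
    fix t :: real
    have "\<bar>r\<^sup>2\<bar> * (indicator {0..} (0 + r\<^sup>2 * t) * (0 + r\<^sup>2 * t) powr e * exp_remainder (0 + r\<^sup>2 * t)) =
      r powr (- q) * (indicator {0..} t * t powr e * exp_remainder (t * r\<^sup>2))"
    proof (cases "t \<ge> 0")
      case True
      have ind: "indicator {0..} (0 + r\<^sup>2 * t) = (1 :: real)" "indicator {0..} t = (1 :: real)"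
        using True by auto
      have "r\<^sup>2 * (r\<^sup>2 * t) powr e = r powr 2 * ((r powr 2) powr e * t powr e)"
        using r True by (simp add: powr_mult powr_numeral)
      also have "\<dots> = (r powr 2 * r powr (- q - 2)) * t powr e"
        by (simp add: powr_powr right_diff_distrib e_def)
      also have "r powr 2 * r powr (- q - 2) = r powr (- q)"
        by (simp only: powr_add[symmetric]) simp
      finally have E: "r\<^sup>2 * (r\<^sup>2 * t) powr e = r powr (- q) * t powr e" .
      have "\<bar>r\<^sup>2\<bar> * (1 * (0 + r\<^sup>2 * t) powr e * exp_remainder (0 + r\<^sup>2 * t)) =
        (r\<^sup>2 * (r\<^sup>2 * t) powr e) * exp_remainder (r\<^sup>2 * t)"
        by simp
      also have "\<dots> = r powr (- q) * (1 * t powr e * exp_remainder (t * r\<^sup>2))"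
        unfolding E by (simp add: mult.commute)
      finally show ?thesis unfolding ind .
    next
      case False
      then have "r\<^sup>2 * t < 0" using r by (simp add: mult_pos_neg)
      then show ?thesis using False by simp
    qed
    then show "ennreal \<bar>r\<^sup>2\<bar> * ennreal (indicator {0..} (0 + r\<^sup>2 * t) * (0 + r\<^sup>2 * t) powr e * exp_remainder (0 + r\<^sup>2 * t)) =
      ennreal (r powr (- q)) * (ennreal (indicator {0..} t * t powr e) * ennreal (exp_remainder (t * r\<^sup>2)))"
      by (simp only: ennreal_mult'[symmetric] abs_ge_zero powr_ge_zero mult_nonneg_nonneg indicator_pos_le)
  qed
  also have "\<dots> = ennreal (r powr (- q)) * (\<integral>\<^sup>+t. ennreal (indicator {0..} t * t powr e) * ennreal (exp_remainder (t * r\<^sup>2)) \<partial>lborel)"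
    by (rule nn_integral_cmult) simp
  finally have "remainder_mass q * ennreal (r powr q) = ennreal (r powr q) * ennreal (r powr (- q)) *
      (\<integral>\<^sup>+t. ennreal (indicator {0..} t * t powr e) * ennreal (exp_remainder (t * r\<^sup>2)) \<partial>lborel)"
    by (simp add: ac_simps)
  also have "ennreal (r powr q) * ennreal (r powr (- q)) = 1"
    using r by (simp add: ennreal_mult'[symmetric] powr_add[symmetric])
  finally show ?thesis by (simp add: r_def e_def)
qed

text \<open>An upper bound for the limit kernel is all that is wanted, so Fatou for the inner and
  then the outer integral suffices. Real-valued densities keep the factor \<open>u x * v y\<close>
  finite, as the pointwise limit in \<open>ennreal\<close> requires.\<close>

lemma interaction_Fatou:
  fixes u v :: "'a::euclidean_space \<Rightarrow> real"
  assumes [measurable]: "\<And>i. k i \<in> borel_measurable borel"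
    "u \<in> borel_measurable borel" "v \<in> borel_measurable borel"
    and lim: "\<And>z. (\<lambda>i. k i z) \<longlonglongrightarrow> K z"
    and le: "\<And>i. interaction (k i) u v \<le> B"
  shows "interaction K u v \<le> B"
proof -
  have "interaction K u v = (\<integral>\<^sup>+x. \<integral>\<^sup>+y. liminf (\<lambda>i. k i (x - y) * u x * v y) \<partial>lborel \<partial>lborel)"
    unfolding interaction_def
  proof (rule nn_integral_cong, rule nn_integral_cong)
    fix x y :: 'a
    have "(\<lambda>i. (ennreal (u x) * ennreal (v y)) * k i (x - y)) \<longlonglongrightarrow> (ennreal (u x) * ennreal (v y)) * K (x - y)"
      by (intro ennreal_tendsto_cmult lim) (simp add: ennreal_mult_less_top)
    from lim_imp_Liminf[OF sequentially_bot this]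
    show "K (x - y) * ennreal (u x) * ennreal (v y) = liminf (\<lambda>i. k i (x - y) * u x * v y)"
      by (simp add: ac_simps)
  qed
  also have "\<dots> \<le> (\<integral>\<^sup>+x. liminf (\<lambda>i. \<integral>\<^sup>+y. k i (x - y) * u x * v y \<partial>lborel) \<partial>lborel)"
    by (intro nn_integral_mono nn_integral_liminf) simp
  also have "\<dots> \<le> liminf (\<lambda>i. interaction (k i) u v)"
    unfolding interaction_def by (intro nn_integral_liminf) simp
  also have "\<dots> \<le> liminf (\<lambda>i. B)"
    by (intro Liminf_mono always_eventually allI le)
  finally show ?thesis by (simp add: Liminf_const)
qed

section \<open>Moments of densities and the interactions with kernels 1 and |z|^2\<close>

lemma nn_integral_has_bochner_integral:
  assumes "has_bochner_integral M f c" "\<And>x. 0 \<le> f x"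
  shows "(\<integral>\<^sup>+x. ennreal (f x) \<partial>M) = ennreal c"
  using assms by (subst nn_integral_eq_integral) (auto simp: has_bochner_integral_iff)

locale finite_second_moment =
  fixes u :: "'a::euclidean_space \<Rightarrow> real"
  assumes measurable [measurable]: "u \<in> borel_measurable borel"
    and nonneg: "0 \<le> u x"
    and integrable: "integrable lborel u"
    and integrable_square: "integrable lborel (\<lambda>x. (norm x)\<^sup>2 * u x)"

definition total_mass :: "('a::euclidean_space \<Rightarrow> real) \<Rightarrow> real" where
  "total_mass u = (\<integral>x. u x \<partial>lborel)"

definition first_moment :: "('a::euclidean_space \<Rightarrow> real) \<Rightarrow> 'a" where
  "first_moment u = (\<integral>x. u x *\<^sub>R x \<partial>lborel)"

definition second_moment :: "('a::euclidean_space \<Rightarrow> real) \<Rightarrow> real" where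
  "second_moment u = (\<integral>x. (norm x)\<^sup>2 * u x \<partial>lborel)"

context finite_second_moment
begin

lemma integrable_first: "integrable lborel (\<lambda>x. u x *\<^sub>R x)"
proof (rule Bochner_Integration.integrable_bound)
  show "integrable lborel (\<lambda>x. u x + (norm x)\<^sup>2 * u x)"
    by (intro Bochner_Integration.integrable_add integrable integrable_square)
  show "AE x in lborel. norm (u x *\<^sub>R x) \<le> norm (u x + (norm x)\<^sup>2 * u x)"
  proof (rule AE_I2)
    fix x :: 'a
    have "norm x \<le> 1 + (norm x)\<^sup>2"
      using zero_le_power2[of "norm x - 1 / 2"] by (simp add: power2_eq_square algebra_simps del: zero_le_power2)
    then have "u x * norm x \<le> u x * (1 + (norm x)\<^sup>2)"
      by (intro mult_left_mono nonneg)
    then show "norm (u x *\<^sub>R x) \<le> norm (u x + (norm x)\<^sup>2 * u x)"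
      using nonneg[of x] by (simp add: algebra_simps)
  qed
qed simp

lemma has_bochner_integral_mass: "has_bochner_integral lborel u (total_mass u)"
  unfolding total_mass_def by (rule has_bochner_integral_integrable[OF integrable])

lemma has_bochner_integral_first:
  "has_bochner_integral lborel (\<lambda>x. u x *\<^sub>R x) (first_moment u)"
  unfolding first_moment_def by (rule has_bochner_integral_integrable[OF integrable_first])

lemma has_bochner_integral_second:
  "has_bochner_integral lborel (\<lambda>x. (norm x)\<^sup>2 * u x) (second_moment u)"
  unfolding second_moment_def by (rule has_bochner_integral_integrable[OF integrable_square])

lemma nn_integral_mass: "(\<integral>\<^sup>+x. ennreal (u x) \<partial>lborel) = ennreal (total_mass u)"
  by (rule nn_integral_has_bochner_integral[OF has_bochner_integral_mass nonneg])

lemma has_bochner_integral_square_dist: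
  "has_bochner_integral lborel (\<lambda>y. (norm (x - y))\<^sup>2 * u y)
     ((norm x)\<^sup>2 * total_mass u - 2 * (x \<bullet> first_moment u) + second_moment u)"
proof -
  have "has_bochner_integral lborel
    (\<lambda>y. (norm x)\<^sup>2 * u y - 2 * (x \<bullet> (u y *\<^sub>R y)) + (norm y)\<^sup>2 * u y)
    ((norm x)\<^sup>2 * total_mass u - 2 * (x \<bullet> first_moment u) + second_moment u)"
    by (intro has_bochner_integral_add has_bochner_integral_diff has_bochner_integral_mult_right
        has_bochner_integral_inner_right has_bochner_integral_mass has_bochner_integral_first
        has_bochner_integral_second)
  moreover have "(norm x)\<^sup>2 * u y - 2 * (x \<bullet> (u y *\<^sub>R y)) + (norm y)\<^sup>2 * u y = (norm (x - y))\<^sup>2 * u y" for y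
    unfolding power2_norm_eq_inner by (simp add: inner_simps inner_commute algebra_simps)
  ultimately show ?thesis by simp
qed

end

lemma interaction_one:
  assumes "finite_second_moment u" "finite_second_moment v"
  shows "interaction (\<lambda>z. 1) u v = ennreal (total_mass u * total_mass v)"
proof -
  interpret u: finite_second_moment u by fact
  interpret v: finite_second_moment v by fact
  have "0 \<le> total_mass u" unfolding total_mass_def by (intro Bochner_Integration.integral_nonneg u.nonneg)
  then show ?thesis
    unfolding interaction_def
    by (simp add: nn_integral_cmult nn_integral_multc u.nn_integral_mass v.nn_integral_mass ennreal_mult')
qed

text \<open>Expanding |x - y|^2 leaves only moments. Second moments occur multiplied by masses, so
  they balance when the masses agree; the middle term balances when the first moments agree.\<close>

lemma interaction_square:
  assumes "finite_second_moment u" "finite_second_moment v"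
  shows "interaction (\<lambda>z. ennreal ((norm z)\<^sup>2)) u v =
    ennreal (second_moment u * total_mass v - 2 * (first_moment u \<bullet> first_moment v) + total_mass u * second_moment v)"
proof -
  interpret u: finite_second_moment u by fact
  interpret v: finite_second_moment v by fact
  let ?F = "\<lambda>x. (norm x)\<^sup>2 * total_mass v - 2 * (x \<bullet> first_moment v) + second_moment v"
  have inner: "(\<integral>\<^sup>+y. ennreal ((norm (x - y))\<^sup>2) * u x * v y \<partial>lborel) = ennreal (u x * ?F x)" for x
  proof -
    have "(\<integral>\<^sup>+y. ennreal ((norm (x - y))\<^sup>2) * u x * v y \<partial>lborel) =
      (\<integral>\<^sup>+y. ennreal (u x * ((norm (x - y))\<^sup>2 * v y)) \<partial>lborel)"
      using u.nonneg v.nonneg by (intro nn_integral_cong) (simp add: ennreal_mult ac_simps)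
    also have "\<dots> = ennreal (u x * ?F x)"
      using u.nonneg v.nonneg
      by (intro nn_integral_has_bochner_integral has_bochner_integral_mult_right v.has_bochner_integral_square_dist) auto
    finally show ?thesis .
  qed
  have F: "?F x \<ge> 0" for x
  proof -
    have "?F x = (\<integral>y. (norm (x - y))\<^sup>2 * v y \<partial>lborel)"
      by (rule has_bochner_integral_integral_eq[OF v.has_bochner_integral_square_dist, symmetric])
    then show ?thesis using v.nonneg by (simp add: Bochner_Integration.integral_nonneg)
  qed
  have eq: "u x * ?F x = (norm x)\<^sup>2 * u x * total_mass v - 2 * ((u x *\<^sub>R x) \<bullet> first_moment v) + u x * second_moment v" for x
    by (simp add: algebra_simps)
  have "has_bochner_integral lborel (\<lambda>x. u x * ?F x)
    (second_moment u * total_mass v - 2 * (first_moment u \<bullet> first_moment v) + total_mass u * second_moment v)"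
    unfolding eq
    by (intro has_bochner_integral_add has_bochner_integral_diff has_bochner_integral_mult_right
        has_bochner_integral_mult_left
        has_bochner_integral_inner_left u.has_bochner_integral_mass u.has_bochner_integral_first
        u.has_bochner_integral_second)
  then show ?thesis
    unfolding interaction_def inner using u.nonneg F
    by (intro nn_integral_has_bochner_integral) auto
qed

section \<open>Weak convexity for densities of equal mass and centre\<close>

locale same_moments = u: finite_second_moment u + v: finite_second_moment v
  for u v :: "'a::euclidean_space \<Rightarrow> real" +
  assumes same_mass: "total_mass u = total_mass v"
    and same_first: "first_moment u = first_moment v"
begin

lemmas fsm = u.finite_second_moment_axioms v.finite_second_moment_axioms

lemma interaction_one_balance:
  "interaction (\<lambda>z. 1) u u + interaction (\<lambda>z. 1) v v = 2 * interaction (\<lambda>z. 1) u v"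
  by (simp add: interaction_one fsm same_mass mult_2)

lemma interaction_square_balance:
  "interaction (\<lambda>z. ennreal ((norm z)\<^sup>2)) u u + interaction (\<lambda>z. ennreal ((norm z)\<^sup>2)) v v =
    2 * interaction (\<lambda>z. ennreal ((norm z)\<^sup>2)) u v"
proof -
  define a where "a = total_mass v"
  define c where "c = first_moment v \<bullet> first_moment v"
  define s where "s = second_moment u"
  define t where "t = second_moment v"
  \<comment> \<open>\<open>ennreal\<close> sends negative reals to 0, so the identity between
    moments transfers only once each of the three values is known to be nonnegative.\<close>
  have nn: "s * a - 2 * c + a * s \<ge> 0" "t * a - 2 * c + a * t \<ge> 0" "s * a - 2 * c + a * t \<ge> 0"
    if "c \<le> a * s" "c \<le> a * t" using that by (auto simp: mult.commute)
  \<comment> \<open>Cauchy-Schwarz for the moments, read off from the nonnegative second moment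
    about the centre of mass. Zero mass is treated separately because there is then no
    centre.\<close>
  have cs: "first_moment w \<bullet> first_moment w \<le> total_mass w * second_moment w"
    if "finite_second_moment w" for w :: "'a \<Rightarrow> real"
  proof -
    interpret w: finite_second_moment w by fact
    show ?thesis
    proof (cases "total_mass w = 0")
      case True
      then have "AE x in lborel. w x = 0"
        using integral_nonneg_eq_0_iff_AE[OF w.integrable] w.nonneg by (simp add: total_mass_def)
      then have "AE x in lborel. w x *\<^sub>R x = 0" by eventually_elim simp
      then have "first_moment w = 0"
        unfolding first_moment_def by (rule integral_eq_zero_AE)
      then show ?thesis using True by simp
    next
      case False
      moreover have "total_mass w \<ge> 0"
        unfolding total_mass_def by (intro Bochner_Integration.integral_nonneg w.nonneg)
      ultimately have pos: "total_mass w > 0" by simp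
      let ?x = "first_moment w /\<^sub>R total_mass w"
      have "0 \<le> (\<integral>y. (norm (?x - y))\<^sup>2 * w y \<partial>lborel)"
        using w.nonneg by (intro Bochner_Integration.integral_nonneg) simp
      also have "\<dots> = (norm ?x)\<^sup>2 * total_mass w - 2 * (?x \<bullet> first_moment w) + second_moment w"
        by (rule has_bochner_integral_integral_eq[OF w.has_bochner_integral_square_dist])
      also have "\<dots> = second_moment w - (first_moment w \<bullet> first_moment w) / total_mass w"
        using pos unfolding power2_norm_eq_inner by (simp add: field_simps)
      finally show ?thesis using pos by (simp add: field_simps)
    qed
  qed
  have "c \<le> a * s" "c \<le> a * t"
    using cs[OF fsm(1)] cs[OF fsm(2)] by (simp_all add: a_def c_def s_def t_def same_mass same_first)
  from nn[OF this] show ?thesis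
    by (simp add: interaction_square fsm same_mass same_first a_def[symmetric] c_def[symmetric] s_def[symmetric]
        t_def[symmetric] ennreal_plus[symmetric] mult_2 algebra_simps del: ennreal_plus)
qed

text \<open>Adding 1 to the remainder gives a Gaussian plus t |z|^2, so all kernels are nonnegative.
  The square terms match by the balance, the Gaussian terms have the right sign, and the interaction
  with kernel 1 is finite and can be cancelled.\<close>

lemma interaction_exp_remainder_le:
  assumes t: "t > 0"
  defines "K \<equiv> \<lambda>z. ennreal (exp_remainder (t * (norm z)\<^sup>2))"
  shows "2 * interaction K u v \<le> interaction K u u + interaction K v v"
proof -
  define S where "S = (\<lambda>z :: 'a. ennreal ((norm z)\<^sup>2))"
  have [measurable]: "K \<in> borel_measurable borel" "S \<in> borel_measurable borel"
    unfolding K_def S_def by measurable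
  have "K z + 1 = gauss t z + ennreal t * S z" for z
  proof -
    have "ennreal (exp_remainder (t * (norm z)\<^sup>2)) + ennreal 1 = ennreal (exp (- t * (norm z)\<^sup>2)) + ennreal (t * (norm z)\<^sup>2)"
      using t exp_remainder_nonneg by (subst (1 2) ennreal_plus[symmetric]) (auto simp: exp_remainder_def)
    then show ?thesis using t by (simp add: K_def S_def gauss_def ennreal_mult)
  qed
  then have eq: "interaction K f g + interaction (\<lambda>z. 1) f g = interaction (gauss t) f g + ennreal t * interaction S f g"
    if [measurable]: "f \<in> borel_measurable borel" "g \<in> borel_measurable borel" for f g :: "'a \<Rightarrow> ennreal"
    by (simp add: interaction_add_kernel[symmetric] interaction_cmult_kernel[symmetric])
  have "2 * interaction K u v + 2 * interaction (\<lambda>z. 1) u v =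
    2 * interaction (gauss t) u v + ennreal t * (2 * interaction S u v)"
    using eq[of u v] by (simp add: distrib_left[symmetric] mult.left_commute)
  also have "\<dots> \<le> (interaction (gauss t) u u + interaction (gauss t) v v) + ennreal t * (2 * interaction S u v)"
    using interaction_gauss_identity[OF t, of u v] by (intro add_right_mono) simp
  also have "\<dots> = (interaction (gauss t) u u + ennreal t * interaction S u u) +
      (interaction (gauss t) v v + ennreal t * interaction S v v)"
    unfolding S_def interaction_square_balance[symmetric] by (simp add: distrib_left ac_simps)
  also have "\<dots> = (interaction K u u + interaction K v v) + 2 * interaction (\<lambda>z. 1) u v"
    using eq[of u u] eq[of v v] interaction_one_balance[symmetric] by (simp add: ac_simps)
  finally show ?thesis
    by (simp add: interaction_one fsm ennreal_mult_eq_top_iff)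
qed

lemma interaction_power_le:
  assumes q: "2 \<le> q" "q \<le> 4"
  defines "K \<equiv> \<lambda>z. ennreal (norm z powr q)"
  shows "2 * interaction K u v \<le> interaction K u u + interaction K v v"
proof -
  consider "q = 2" | "2 < q" "q < 4" | "q = 4" using q by linarith
  then show ?thesis
  proof cases
    case 1
    then show ?thesis using interaction_square_balance by (simp add: K_def powr_numeral)
  next
    case 2
    define w where "w = (\<lambda>t. ennreal (indicator {0..} t * t powr (- q / 2 - 1)))"
    define k where "k = (\<lambda>t (z::'a). ennreal (exp_remainder (t * (norm z)\<^sup>2)))"
    have [measurable]: "w \<in> borel_measurable borel" "(\<lambda>(t, z). k t z) \<in> borel_measurable (borel \<Otimes>\<^sub>M borel)"
      unfolding w_def k_def by measurable
    have [measurable]: "(\<lambda>t. interaction (k t) f g) \<in> borel_measurable borel"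
      if [measurable]: "f \<in> borel_measurable borel" "g \<in> borel_measurable borel" for f g :: "'a \<Rightarrow> ennreal"
      unfolding interaction_def by measurable
    have mix: "remainder_mass q * interaction K f g = (\<integral>\<^sup>+t. w t * interaction (k t) f g \<partial>lborel)"
      if [measurable]: "f \<in> borel_measurable borel" "g \<in> borel_measurable borel" for f g :: "'a \<Rightarrow> ennreal"
    proof -
      have "remainder_mass q * interaction K f g = interaction (\<lambda>z. remainder_mass q * K z) f g"
        by (simp add: interaction_cmult_kernel K_def)
      also have "\<dots> = interaction (\<lambda>z. \<integral>\<^sup>+t. w t * k t z \<partial>lborel) f g"
        unfolding K_def k_def w_def by (intro interaction_cong_kernel remainder_mass_powr)
      also have "\<dots> = (\<integral>\<^sup>+t. w t * interaction (k t) f g \<partial>lborel)"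
        by (rule interaction_mixture) auto
      finally show ?thesis .
    qed
    have "remainder_mass q * (2 * interaction K u v) = (\<integral>\<^sup>+t. w t * (2 * interaction (k t) u v) \<partial>lborel)"
      by (simp add: mult.left_commute[of _ 2] mix nn_integral_cmult)
    also have "\<dots> \<le> (\<integral>\<^sup>+t. w t * (interaction (k t) u u + interaction (k t) v v) \<partial>lborel)"
    proof (rule nn_integral_mono_AE, use AE_lborel_singleton[of "0::real"] in eventually_elim)
      fix t :: real assume "t \<noteq> 0"
      then show "w t * (2 * interaction (k t) u v) \<le> w t * (interaction (k t) u u + interaction (k t) v v)"
        using interaction_exp_remainder_le[of t]
        by (cases "t > 0") (auto simp: k_def w_def intro!: mult_left_mono)
    qed
    also have "\<dots> = remainder_mass q * (interaction K u u + interaction K v v)"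
      by (simp add: distrib_left nn_integral_add mix)
    finally show ?thesis
      using remainder_mass_pos[of q] remainder_mass_finite[OF 2]
      by (subst (asm) ennreal_mult_le_mult_iff) auto
  next
    case 3
    \<comment> \<open>For q = 4 the mixture integral diverges at t = 0. Instead, 2/t^2 times the
      remainder at t |z|^2 tends to |z|^4 as t -> 0, here along t = 1/(i + 1).\<close>
    define t where "t = (\<lambda>i::nat. 1 / (real i + 1))"
    define k where "k = (\<lambda>i (z::'a). ennreal (2 / (t i)\<^sup>2) * ennreal (exp_remainder (t i * (norm z)\<^sup>2)))"
    have t: "t i > 0" for i by (simp add: t_def)
    have K: "K z = ennreal ((norm z) ^ 4)" for z by (simp add: K_def 3 powr_numeral)
    have [measurable]: "k i \<in> borel_measurable borel" for i unfolding k_def by measurable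
    have k_eq: "k i z = ennreal (2 / (t i)\<^sup>2 * exp_remainder (t i * (norm z)\<^sup>2))" for i z
      unfolding k_def by (rule ennreal_mult'[symmetric]) simp
    have k_le: "k i z \<le> K z" for i z
    proof -
      have "2 / (t i)\<^sup>2 * exp_remainder (t i * (norm z)\<^sup>2) \<le> 2 / (t i)\<^sup>2 * ((t i * (norm z)\<^sup>2)\<^sup>2 / 2)"
        using t[of i] by (intro mult_left_mono exp_remainder_le_square) auto
      also have "\<dots> = norm z ^ 4"
        using t[of i] by (simp add: power_mult_distrib power_mult[symmetric])
      finally show ?thesis unfolding k_eq K by (rule ennreal_leI)
    qed
    have lim: "(\<lambda>i. k i z) \<longlonglongrightarrow> K z" for z
    proof (cases "z = 0")
      case True
      then show ?thesis by (simp add: k_def K exp_remainder_def)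
    next
      case False
      define c where "c = (norm z)\<^sup>2"
      have c: "c > 0" using False by (simp add: c_def)
      have "(\<lambda>i. 2 / (t i)\<^sup>2 * exp_remainder (t i * c)) \<longlonglongrightarrow> c\<^sup>2"
        unfolding t_def exp_remainder_def using c by (real_asymp simp: power2_eq_square)
      moreover have "c\<^sup>2 = norm z ^ 4" by (simp add: c_def power_mult[symmetric])
      ultimately show ?thesis unfolding k_eq K c_def by (intro tendsto_ennrealI) simp
    qed
    \<comment> \<open>Since \<open>k i\<close> lies below \<open>K\<close>, the self-interactions
      are bounded by those of \<open>K\<close>; only the cross term passes to the limit, and for it
      Fatou points in the right direction.\<close>
    have le: "interaction (k i) u v \<le> (interaction K u u + interaction K v v) / 2" for i
    proof -
      have k: "interaction (k i) f g =
          ennreal (2 / (t i)\<^sup>2) * interaction (\<lambda>z. ennreal (exp_remainder (t i * (norm z)\<^sup>2))) f g"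
        if [measurable]: "f \<in> borel_measurable borel" "g \<in> borel_measurable borel" for f g :: "'a \<Rightarrow> ennreal"
        unfolding k_def by (rule interaction_cmult_kernel) auto
      have "2 * interaction (k i) u v \<le> interaction (k i) u u + interaction (k i) v v"
        using mult_left_mono[OF interaction_exp_remainder_le[OF t[of i]], of "ennreal (2 / (t i)\<^sup>2)"]
        by (simp add: k distrib_left mult.left_commute)
      also have "\<dots> \<le> interaction K u u + interaction K v v"
        by (intro add_mono interaction_mono_kernel k_le)
      finally have "2 * interaction (k i) u v / 2 \<le> (interaction K u u + interaction K v v) / 2"
        by (rule divide_right_mono_ennreal)
      then show ?thesis by (simp add: mult.commute[of 2] ennreal_mult_divide_eq)
    qed
    have "interaction K u v \<le> (interaction K u u + interaction K v v) / 2"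
      by (rule interaction_Fatou[OF _ _ _ lim le]) auto
    then have "2 * interaction K u v \<le> 2 * ((interaction K u u + interaction K v v) / 2)"
      by (rule mult_left_mono) simp
    also have "\<dots> = interaction K u u + interaction K v v"
      by (subst ennreal_times_divide, subst mult.commute, rule ennreal_mult_divide_eq) auto
    finally show ?thesis .
  qed
qed

end

section \<open>Injectivity of the Gaussian transforms\<close>

lemma nn_integral_lborel_affine:
  fixes f :: "'a::euclidean_space \<Rightarrow> ennreal"
  assumes [measurable]: "f \<in> borel_measurable borel" and c: "c \<noteq> 0"
  shows "(\<integral>\<^sup>+x. f x \<partial>lborel) = ennreal (\<bar>c\<bar> ^ DIM('a)) * (\<integral>\<^sup>+x. f (t + c *\<^sub>R x) \<partial>lborel)"
  by (subst lborel_affine[OF c, of t]) (simp add: nn_integral_density nn_integral_distr nn_integral_cmult)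

lemma AE_lborel_not_frontier_box:
  fixes a b :: "'a::euclidean_space"
  shows "AE x in lborel. x \<notin> cbox a b - box a b"
proof -
  have "cbox a b - box a b \<in> null_sets lebesgue"
    using negligible_frontier_interval by (simp add: negligible_iff_null_sets)
  from AE_not_in[OF this] show ?thesis by (simp add: AE_completion_iff)
qed

text \<open>Open boxes form an intersection-stable generator of the Borel sets; the finite integral
  of f provides the finiteness along an exhaustion by boxes that uniqueness of measures
  demands.\<close>

lemma AE_lborel_eq_if_box_integrals_eq:
  fixes f g :: "'a::euclidean_space \<Rightarrow> ennreal"
  assumes [measurable]: "f \<in> borel_measurable borel" "g \<in> borel_measurable borel"
    and fin: "(\<integral>\<^sup>+x. f x \<partial>lborel) < top"
    and eq: "\<And>a b. (\<integral>\<^sup>+x. f x * indicator (box a b) x \<partial>lborel) = (\<integral>\<^sup>+x. g x * indicator (box a b) x \<partial>lborel)"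
  shows "AE x in lborel. f x = g x"
proof (rule sigma_finite_measure.density_unique[OF sigma_finite_lborel])
  show "density lborel f = density lborel g"
  proof (rule measure_eqI_generator_eq)
    let ?E = "range (\<lambda>(a, b). box a b::'a set)"
    show "Int_stable ?E"
      by (auto simp: Int_stable_def box_Int_box)
    show "?E \<subseteq> Pow UNIV" "sets (density lborel f) = sigma_sets UNIV ?E"
      "sets (density lborel g) = sigma_sets UNIV ?E"
      by (simp_all add: borel_eq_box)
    let ?A = "\<lambda>n::nat. box (- (real n *\<^sub>R One)) (real n *\<^sub>R One) :: 'a set"
    show "range ?A \<subseteq> ?E" "(\<Union>i. ?A i) = UNIV"
      unfolding UN_box_eq_UNIV by auto
    show "emeasure (density lborel f) (?A i) \<noteq> \<infinity>" for i
    proof -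
      have "emeasure (density lborel f) (?A i) \<le> (\<integral>\<^sup>+x. f x \<partial>lborel)"
        by (simp add: emeasure_density) (intro nn_integral_mono, simp add: indicator_def)
      then show ?thesis using fin by (auto simp: top_unique)
    qed
    show "emeasure (density lborel f) X = emeasure (density lborel g) X" if "X \<in> ?E" for X
      using that by (auto simp: emeasure_density eq)
  qed
qed auto

text \<open>As t grows, normalised Gaussians concentrate at a point. When the transform is tested
  against a box, Tonelli moves the Gaussian onto the indicator, and the smoothed indicators
  converge, so u and v have equal box integrals. Equality is asked only for arbitrarily large t
  because it will be known only for almost every t.\<close>

lemma gauss_transform_injective:
  fixes u v :: "'a::euclidean_space \<Rightarrow> real"
  assumes [measurable]: "u \<in> borel_measurable borel" "v \<in> borel_measurable borel"
    and fin: "(\<integral>\<^sup>+x. ennreal (u x) \<partial>lborel) < top" "(\<integral>\<^sup>+x. ennreal (v x) \<partial>lborel) < top"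
    and ex: "\<And>T. \<exists>t>T. AE z in lborel. gauss_transform t u z = gauss_transform t v z"
  shows "AE x in lborel. ennreal (u x) = ennreal (v x)"
proof (rule AE_lborel_eq_if_box_integrals_eq)
  fix a b :: 'a
  define A where "A = ennreal (gauss_mass TYPE('a) 1)"
  have A: "A \<noteq> 0" "A < top" using gauss_mass_pos[of 1, where 'a='a] by (auto simp: A_def)
  have A_eq: "(\<integral>\<^sup>+y. gauss 1 (y::'a) \<partial>lborel) = A" by (simp add: nn_integral_gauss A_def)
  have "\<forall>k::nat. \<exists>t. t > real k \<and> (AE z in lborel. gauss_transform t u z = gauss_transform t v z)"
    using ex by blast
  from choice[OF this] obtain t where t: "\<And>k::nat. t k > real k"
    and eq: "\<And>k. AE z in lborel. gauss_transform (t k) u z = gauss_transform (t k) v z"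
    by blast
  have t_pos: "t k > 0" for k using t[of k] by linarith
  \<comment> \<open>The width for which the substitution z = x + s y turns
    \<open>gauss (t k)\<close> into \<open>gauss 1\<close>.\<close>
  define s where "s = (\<lambda>k. 1 / sqrt (t k))"
  have s_pos: "s k > 0" for k using t_pos[of k] by (simp add: s_def)
  have ts: "t k * (s k)\<^sup>2 = 1" for k using t_pos[of k] by (simp add: s_def power_divide)
  have s_lim: "s \<longlonglongrightarrow> 0"
  proof -
    have "filterlim t at_top sequentially"
      by (rule filterlim_at_top_mono[OF filterlim_real_sequentially]) (use t in \<open>auto intro!: always_eventually less_imp_le\<close>)
    then have "filterlim (\<lambda>k. sqrt (t k)) at_top sequentially"
      by (rule filterlim_compose[OF sqrt_at_top])
    then show ?thesis unfolding s_def by (rule real_tendsto_divide_at_top[OF tendsto_const])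
  qed
  \<comment> \<open>The indicator smoothed at width \<open>s k\<close>, without normalisation; hence
    its limit carries the factor \<open>A\<close>.\<close>
  define H where "H = (\<lambda>k x. \<integral>\<^sup>+y. gauss 1 y * indicator (box a b) (x + s k *\<^sub>R y) \<partial>lborel)"
  have [measurable]: "H k \<in> borel_measurable borel" for k unfolding H_def by measurable
  have H_le: "H k x \<le> A" for k x
    unfolding H_def A_eq[symmetric] by (intro nn_integral_mono) (simp add: indicator_def)
  \<comment> \<open>The indicator is locally constant inside the open box and outside the closed
    one; on the boundary, a null set, the limit may differ.\<close>
  have H_lim: "(\<lambda>k. H k x) \<longlonglongrightarrow> A * indicator (box a b) x" if x: "x \<notin> cbox a b - box a b" for x
  proof -
    have "(\<lambda>k. \<integral>\<^sup>+y. gauss 1 y * indicator (box a b) (x + s k *\<^sub>R y) \<partial>lborel) \<longlonglongrightarrow>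
      (\<integral>\<^sup>+y. gauss 1 (y::'a) * indicator (box a b) x \<partial>lborel)"
    proof (rule nn_integral_dominated_convergence[where w = "\<lambda>y::'a. gauss 1 y"])
      show "AE y in lborel. (\<lambda>k. gauss 1 y * indicator (box a b) (x + s k *\<^sub>R y)) \<longlonglongrightarrow> gauss 1 y * indicator (box a b) x"
      proof (rule AE_I2)
        fix y :: 'a
        have lim: "(\<lambda>k. x + s k *\<^sub>R y) \<longlonglongrightarrow> x"
          using tendsto_add[OF tendsto_const tendsto_scaleR[OF s_lim tendsto_const], of x y] by simp
        have "eventually (\<lambda>k. indicator (box a b) (x + s k *\<^sub>R y) = (indicator (box a b) x :: ennreal)) sequentially"
        proof (cases "x \<in> box a b")
          case True
          from topological_tendstoD[OF lim open_box True] show ?thesis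
            by eventually_elim (simp add: True)
        next
          case False
          with x have "x \<in> - cbox a b" by auto
          from topological_tendstoD[OF lim _ this] have "eventually (\<lambda>k. x + s k *\<^sub>R y \<in> - cbox a b) sequentially"
            by (simp add: closed_cbox open_Compl)
          then show ?thesis
            by eventually_elim (use False box_subset_cbox[of a b] in \<open>auto simp: indicator_def\<close>)
        qed
        then have "eventually (\<lambda>k. gauss 1 y * indicator (box a b) (x + s k *\<^sub>R y) = gauss 1 y * indicator (box a b) x) sequentially"
          by eventually_elim simp
        then show "(\<lambda>k. gauss 1 y * indicator (box a b) (x + s k *\<^sub>R y)) \<longlonglongrightarrow> gauss 1 y * indicator (box a b) x"
          by (rule tendsto_eventually)
      qed
    qed (use A(2) in \<open>auto simp: A_eq indicator_def\<close>)
    then show ?thesis by (simp add: H_def nn_integral_multc A_eq)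
  qed
  have conv: "(\<lambda>k. \<integral>\<^sup>+x. ennreal (f x) * H k x \<partial>lborel) \<longlonglongrightarrow> A * (\<integral>\<^sup>+x. ennreal (f x) * indicator (box a b) x \<partial>lborel)"
    if [measurable]: "f \<in> borel_measurable borel" and fin: "(\<integral>\<^sup>+x. ennreal (f x) \<partial>lborel) < top" for f :: "'a \<Rightarrow> real"
  proof -
    have "(\<lambda>k. \<integral>\<^sup>+x. ennreal (f x) * H k x \<partial>lborel) \<longlonglongrightarrow> (\<integral>\<^sup>+x. ennreal (f x) * (A * indicator (box a b) x) \<partial>lborel)"
    proof (rule nn_integral_dominated_convergence[where w = "\<lambda>x. ennreal (f x) * A"])
      show "AE x in lborel. (\<lambda>k. ennreal (f x) * H k x) \<longlonglongrightarrow> ennreal (f x) * (A * indicator (box a b) x)"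
        using AE_lborel_not_frontier_box[of a b]
      proof eventually_elim
        case (elim x)
        show ?case by (intro ennreal_tendsto_cmult H_lim elim) simp
      qed
      show "(\<integral>\<^sup>+x. ennreal (f x) * A \<partial>lborel) < \<infinity>"
        using fin A(2) by (simp add: nn_integral_multc ennreal_mult_less_top)
    qed (auto intro!: mult_left_mono H_le)
    then show ?thesis by (simp add: nn_integral_cmult[symmetric] ac_simps)
  qed
  \<comment> \<open>The Jacobian \<open>s k ^ DIM('a)\<close> is the same for u and v and, being
    positive and finite, cancels in the comparison.\<close>
  have trans: "(\<integral>\<^sup>+z. gauss_transform (t k) f z * indicator (box a b) z \<partial>lborel) =
      ennreal (s k ^ DIM('a)) * (\<integral>\<^sup>+x. f x * H k x \<partial>lborel)"
    if [measurable]: "f \<in> borel_measurable borel" for f :: "'a \<Rightarrow> ennreal" and k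
  proof -
    have "(\<integral>\<^sup>+z. gauss_transform (t k) f z * indicator (box a b) z \<partial>lborel) =
      (\<integral>\<^sup>+z. \<integral>\<^sup>+x. gauss (t k) (x - z) * f x * indicator (box a b) z \<partial>lborel \<partial>lborel)"
      unfolding gauss_transform_def by (simp add: nn_integral_multc)
    also have "\<dots> = (\<integral>\<^sup>+x. \<integral>\<^sup>+z. gauss (t k) (x - z) * f x * indicator (box a b) z \<partial>lborel \<partial>lborel)"
      by (rule lborel_pair.Fubini') simp
    also have "\<dots> = (\<integral>\<^sup>+x. ennreal (s k ^ DIM('a)) * (f x * H k x) \<partial>lborel)"
    proof (rule nn_integral_cong)
      fix x :: 'a
      have scale: "gauss (t k) (x - (x + s k *\<^sub>R y)) = gauss 1 y" for y :: 'a
      proof -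
        have "t k * (norm (x - (x + s k *\<^sub>R y)))\<^sup>2 = (t k * (s k)\<^sup>2) * (norm y)\<^sup>2"
          by (simp add: power_mult_distrib)
        then show ?thesis unfolding gauss_def ts by simp
      qed
      have "(\<integral>\<^sup>+z. gauss (t k) (x - z) * f x * indicator (box a b) z \<partial>lborel) =
        ennreal (\<bar>s k\<bar> ^ DIM('a)) * (\<integral>\<^sup>+y. gauss (t k) (x - (x + s k *\<^sub>R y)) * f x * indicator (box a b) (x + s k *\<^sub>R y) \<partial>lborel)"
        using s_pos[of k] by (intro nn_integral_lborel_affine) auto
      also have "\<dots> = ennreal (s k ^ DIM('a)) * (\<integral>\<^sup>+y. f x * (gauss 1 y * indicator (box a b) (x + s k *\<^sub>R y)) \<partial>lborel)"
        unfolding scale using s_pos[of k] by (simp add: ac_simps)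
      finally show "(\<integral>\<^sup>+z. gauss (t k) (x - z) * f x * indicator (box a b) z \<partial>lborel) =
        ennreal (s k ^ DIM('a)) * (f x * H k x)"
        by (simp add: H_def nn_integral_cmult)
    qed
    finally show ?thesis by (simp add: nn_integral_cmult)
  qed
  have "(\<integral>\<^sup>+x. ennreal (u x) * H k x \<partial>lborel) = (\<integral>\<^sup>+x. ennreal (v x) * H k x \<partial>lborel)" for k
  proof -
    have "(\<integral>\<^sup>+z. gauss_transform (t k) u z * indicator (box a b) z \<partial>lborel) =
      (\<integral>\<^sup>+z. gauss_transform (t k) v z * indicator (box a b) z \<partial>lborel)"
      using eq[of k] by (intro nn_integral_cong_AE) auto
    then show ?thesis
      using s_pos[of k] by (simp add: trans ennreal_mult_cancel_left)
  qed
  with conv[of u] conv[of v] fin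
  have "A * (\<integral>\<^sup>+x. ennreal (u x) * indicator (box a b) x \<partial>lborel) = A * (\<integral>\<^sup>+x. ennreal (v x) * indicator (box a b) x \<partial>lborel)"
    by (auto intro: LIMSEQ_unique)
  then show "(\<integral>\<^sup>+x. ennreal (u x) * indicator (box a b) x \<partial>lborel) = (\<integral>\<^sup>+x. ennreal (v x) * indicator (box a b) x \<partial>lborel)"
    using A by (auto simp: ennreal_mult_cancel_left)
qed (use fin in auto)

lemma AE_eq_if_gauss_discrepancy_zero:
  fixes u v :: "'a::euclidean_space \<Rightarrow> real"
  assumes [measurable]: "u \<in> borel_measurable borel" "v \<in> borel_measurable borel"
    and fin: "(\<integral>\<^sup>+x. ennreal (u x) \<partial>lborel) < top" "(\<integral>\<^sup>+x. ennreal (v x) \<partial>lborel) < top"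
    and zero: "AE t in lborel. 0 < t \<longrightarrow> gauss_discrepancy t u v = 0"
  shows "AE x in lborel. ennreal (u x) = ennreal (v x)"
proof (rule gauss_transform_injective)
  fix T :: real
  \<comment> \<open>With S >= 0 every t > S is positive and satisfies 2 t > T, where 2 t is the
    parameter of the transforms in the discrepancy. An interval beyond S has positive length and so
    contains a suitable t.\<close>
  define S where "S = max T 0"
  have "\<exists>t>S. gauss_discrepancy t u v = 0"
  proof (rule ccontr)
    assume none: "\<not> ?thesis"
    from zero have "AE t in lborel. t \<notin> {S<..<S + 1}"
      by eventually_elim (use none in \<open>auto simp: S_def\<close>)
    then have "{S<..<S + 1} \<in> null_sets lborel"
      by (subst (asm) AE_iff_null_sets[symmetric]) auto
    then show False by (auto simp: null_sets_def)
  qed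
  then obtain t where t: "t > S" "gauss_discrepancy t u v = 0" by blast
  have "(\<integral>\<^sup>+z. (ennreal_dist (gauss_transform (2 * t) u z) (gauss_transform (2 * t) v z))\<^sup>2 \<partial>lborel) = 0"
    using t(2) unfolding gauss_discrepancy_def by (simp add: divide_ennreal_def)
  then have "AE z in lborel. (ennreal_dist (gauss_transform (2 * t) u z) (gauss_transform (2 * t) v z))\<^sup>2 = 0"
    by (subst (asm) nn_integral_0_iff_AE) auto
  then have "AE z in lborel. gauss_transform (2 * t) u z = gauss_transform (2 * t) v z"
    by eventually_elim (auto intro: ennreal_dist_eq_0_D)
  moreover have "2 * t > T" using t(1) by (simp add: S_def)
  ultimately show "\<exists>t>T. AE z in lborel. gauss_transform t u z = gauss_transform t v z" by blast
qed (use fin in auto)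

section \<open>Equality case for the full kernel\<close>

context same_moments
begin

text \<open>Both powers satisfy the convexity inequality, so the reverse inequality for their sum
  forces equality for the repulsive one, the attractive terms being finite and hence cancellable.
  The defect integral then vanishes, and with it the discrepancy at almost every t > 0.\<close>

lemma AE_eq_if_interaction_balanced:
  assumes q: "2 \<le> q" "q \<le> 4" and p: "p < 0" and ab: "0 < a" "0 < b"
  defines "K \<equiv> \<lambda>z. ennreal (a * norm z powr q + b * norm z powr p)"
  assumes fin: "interaction K u u < top" "interaction K v v < top"
    and le: "interaction K u u + interaction K v v \<le> 2 * interaction K u v"
  shows "AE x in lborel. u x = v x"
proof -
  define Q where "Q = (\<lambda>z::'a. ennreal (norm z powr q))"
  define P where "P = (\<lambda>z::'a. ennreal (norm z powr p))"
  define w where "w = (\<lambda>t. ennreal (indicator {0..} t * t powr (- p / 2 - 1)))"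
  define G where "G = ennreal (Gamma (- p / 2))"
  define D where "D = (\<integral>\<^sup>+t. w t * gauss_discrepancy t u v \<partial>lborel)"
  have [measurable]: "Q \<in> borel_measurable borel" "P \<in> borel_measurable borel" "w \<in> borel_measurable borel"
    unfolding Q_def P_def w_def by measurable
  have "Gamma (- p / 2) > 0" using p by (intro Gamma_real_pos) simp
  then have G: "G \<noteq> 0" "G < top" by (auto simp: G_def)
  have K: "K z = ennreal a * Q z + ennreal b * P z" for z
    using ab by (simp add: K_def Q_def P_def ennreal_mult)
  have K_eq: "interaction K f g = ennreal a * interaction Q f g + ennreal b * interaction P f g"
    if [measurable]: "f \<in> borel_measurable borel" "g \<in> borel_measurable borel" for f g :: "'a \<Rightarrow> ennreal"
    unfolding K by (simp add: interaction_add_kernel interaction_cmult_kernel)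
  define QQ where "QQ = interaction Q u u + interaction Q v v"
  define PP where "PP = interaction P u u + interaction P v v"
  have finQP: "QQ < top" "PP < top"
    using fin ab by (auto simp: QQ_def PP_def K_eq ennreal_mult_less_top)
  have Q_le: "2 * interaction Q u v \<le> QQ"
    using interaction_power_le[OF q] by (simp add: Q_def QQ_def)
  have P_eq: "G * PP = G * (2 * interaction P u v) + D"
    using interaction_negative_power_identity[OF p, of u v]
    by (simp add: G_def PP_def P_def D_def w_def)
  have "ennreal a * QQ + ennreal b * PP \<le> ennreal a * (2 * interaction Q u v) + ennreal b * (2 * interaction P u v)"
    using le by (simp add: K_eq QQ_def PP_def distrib_left ac_simps)
  also have "\<dots> \<le> ennreal a * QQ + ennreal b * (2 * interaction P u v)"
    by (intro add_mono mult_left_mono Q_le) auto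
  finally have "ennreal b * PP \<le> ennreal b * (2 * interaction P u v)"
    using finQP(1)[THEN less_imp_neq] by (simp add: ennreal_mult_eq_top_iff)
  then have P_le: "PP \<le> 2 * interaction P u v"
    using ab by (subst (asm) ennreal_mult_le_mult_iff) auto
  have "G * (2 * interaction P u v) \<le> G * PP"
    unfolding P_eq by simp
  with G have "2 * interaction P u v \<le> PP"
    by (subst (asm) ennreal_mult_le_mult_iff) auto
  with P_le have eq: "2 * interaction P u v = PP" by simp
  have "G * PP + D = G * PP + 0"
    using P_eq eq by simp
  then have "D = 0"
    using G finQP(2) by (subst (asm) ennreal_add_left_cancel) (auto simp: ennreal_mult_eq_top_iff)
  then have "AE t in lborel. w t * gauss_discrepancy t u v = 0"
    unfolding D_def by (subst (asm) nn_integral_0_iff_AE) auto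
  then have "AE t in lborel. 0 < t \<longrightarrow> gauss_discrepancy t u v = 0"
    by eventually_elim (auto simp: w_def)
  then have "AE x in lborel. ennreal (u x) = ennreal (v x)"
    by (intro AE_eq_if_gauss_discrepancy_zero) (auto simp: u.nn_integral_mass v.nn_integral_mass)
  then show ?thesis
    by eventually_elim (use u.nonneg v.nonneg in auto)
qed

end

section \<open>Minimizers\<close>

text \<open>An averaging argument as in the uniqueness proof for Haar measure: the image of Lebesgue
  measure is translation invariant, hence proportional to it, and a radial Gaussian, which T leaves
  unchanged, fixes the factor as 1.\<close>

lemma lborel_distr_orthogonal:
  fixes T :: "'a::euclidean_space \<Rightarrow> 'a"
  assumes T: "orthogonal_transformation T"
  shows "distr lborel borel T = lborel"
proof (rule measure_eqI)
  have lin: "linear T" and norm: "\<And>x. norm (T x) = norm x"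
    using T by (auto simp: orthogonal_transformation)
  have [measurable]: "T \<in> borel_measurable borel"
    using lin by (intro borel_measurable_continuous_onI linear_continuous_on linear_linear[THEN iffD2])
  obtain S where S: "\<And>y. T (S y) = y"
    using orthogonal_transformation_surj[OF T] by (metis surjD)
  have shift: "(\<integral>\<^sup>+x. f x \<partial>lborel) = (\<integral>\<^sup>+x. f (x + c) \<partial>lborel)"
    if "f \<in> borel_measurable borel" for f :: "'a \<Rightarrow> ennreal" and c
    using nn_integral_lborel_translate[OF that, of "- c"] by simp
  define A where "A = ennreal (gauss_mass TYPE('a) 1)"
  have A: "A \<noteq> 0" "A < top" using gauss_mass_pos[of 1, where 'a='a] by (auto simp: A_def)
  have A_eq: "(\<integral>\<^sup>+y. gauss 1 (y::'a) \<partial>lborel) = A" by (simp add: nn_integral_gauss A_def)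
  fix X assume "X \<in> sets (distr lborel borel T)"
  then have [measurable]: "X \<in> sets borel" by simp
  let ?g = "indicator X :: 'a \<Rightarrow> ennreal"
  have "A * (\<integral>\<^sup>+x. ?g (T x) \<partial>lborel) = (\<integral>\<^sup>+y. gauss 1 (y::'a) * (\<integral>\<^sup>+x. ?g (T x) \<partial>lborel) \<partial>lborel)"
    by (simp add: nn_integral_multc A_eq)
  also have "\<dots> = (\<integral>\<^sup>+y. \<integral>\<^sup>+x. gauss 1 y * ?g (T x + y) \<partial>lborel \<partial>lborel)"
  proof (rule nn_integral_cong)
    \<comment> \<open>Shifting x by \<open>S y\<close>, a preimage of y, shifts \<open>T x\<close>
      by y.\<close>
    fix y :: 'a
    have "(\<integral>\<^sup>+x. ?g (T x) \<partial>lborel) = (\<integral>\<^sup>+x. ?g (T (x + S y)) \<partial>lborel)"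
      by (rule shift) simp
    then show "gauss 1 y * (\<integral>\<^sup>+x. ?g (T x) \<partial>lborel) = (\<integral>\<^sup>+x. gauss 1 y * ?g (T x + y) \<partial>lborel)"
      by (simp add: linear_add[OF lin] S nn_integral_cmult)
  qed
  also have "\<dots> = (\<integral>\<^sup>+x. \<integral>\<^sup>+y. gauss 1 y * ?g (T x + y) \<partial>lborel \<partial>lborel)"
    by (rule lborel_pair.Fubini') simp
  also have "\<dots> = (\<integral>\<^sup>+x. \<integral>\<^sup>+y. gauss 1 (y - T x) * ?g y \<partial>lborel \<partial>lborel)"
  proof (rule nn_integral_cong)
    fix x :: 'a
    have "(\<integral>\<^sup>+y. gauss 1 y * ?g (T x + y) \<partial>lborel) = (\<integral>\<^sup>+y. gauss 1 (y + (- T x)) * ?g (T x + (y + (- T x))) \<partial>lborel)"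
      by (rule shift) simp
    then show "(\<integral>\<^sup>+y. gauss 1 y * ?g (T x + y) \<partial>lborel) = (\<integral>\<^sup>+y. gauss 1 (y - T x) * ?g y \<partial>lborel)"
      by simp
  qed
  also have "\<dots> = (\<integral>\<^sup>+y. \<integral>\<^sup>+x. gauss 1 (y - T x) * ?g y \<partial>lborel \<partial>lborel)"
    by (rule lborel_pair.Fubini') simp
  also have "\<dots> = (\<integral>\<^sup>+y. A * ?g y \<partial>lborel)"
  proof (rule nn_integral_cong)
    fix y :: 'a
    have "gauss 1 (y - T x) = gauss 1 (x - S y)" for x
    proof -
      have "norm (y - T x) = norm (T (S y - x))" by (simp add: linear_diff[OF lin] S)
      then show ?thesis by (simp add: gauss_def norm norm_minus_commute)
    qed
    then show "(\<integral>\<^sup>+x. gauss 1 (y - T x) * ?g y \<partial>lborel) = A * ?g y"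
      by (simp add: nn_integral_multc nn_integral_lborel_translate[of "gauss 1"] A_eq)
  qed
  also have "\<dots> = A * emeasure lborel X" by (simp add: nn_integral_cmult)
  finally have eq: "(\<integral>\<^sup>+x. ?g (T x) \<partial>lborel) = emeasure lborel X"
    using A by (auto simp: ennreal_mult_cancel_left)
  have "emeasure (distr lborel borel T) X = (\<integral>\<^sup>+x. ?g x \<partial>distr lborel borel T)"
    by simp
  also have "\<dots> = (\<integral>\<^sup>+x. ?g (T x) \<partial>lborel)"
    by (rule nn_integral_distr) auto
  finally show "emeasure (distr lborel borel T) X = emeasure lborel X"
    unfolding eq .
qed simp

lemma lborel_distr_minus:
  fixes c :: "'a::euclidean_space"
  shows "distr lborel borel (\<lambda>x. x - c) = lborel"
proof -
  have "(\<lambda>x. x - c) = (+) (- c)" by auto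
  then show ?thesis by (simp only: lborel_distr_plus)
qed

lemma AE_lborel_compose:
  fixes T :: "'a::euclidean_space \<Rightarrow> 'a"
  assumes "T \<in> borel_measurable borel" and T: "distr lborel borel T = lborel" and P: "AE x in lborel. P x"
  shows "AE x in lborel. P (T x)"
proof (rule AE_distrD[of T lborel borel P])
  show "T \<in> lborel \<rightarrow>\<^sub>M borel" using assms(1) by simp
  show "AE x in distr lborel borel T. P x" by (subst T) (rule P)
qed

lemma interaction_isometry:
  fixes u v :: "'a::euclidean_space \<Rightarrow> ennreal"
  assumes [measurable]: "K \<in> borel_measurable borel" "u \<in> borel_measurable borel" "v \<in> borel_measurable borel"
    "T \<in> borel_measurable borel"
    and T: "distr lborel borel T = (lborel :: 'a measure)" and K: "\<And>x y. K (T x - T y) = K (x - y)"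
  shows "interaction K (\<lambda>x. u (T x)) (\<lambda>x. v (T x)) = interaction K u v"
proof -
  have push: "(\<integral>\<^sup>+x. f x \<partial>lborel) = (\<integral>\<^sup>+x. f (T x) \<partial>lborel)" if "f \<in> borel_measurable borel" for f :: "'a \<Rightarrow> ennreal"
    by (subst T[symmetric], subst nn_integral_distr) (use that in auto)
  have "interaction K u v = (\<integral>\<^sup>+x. \<integral>\<^sup>+y. K (T x - y) * u (T x) * v y \<partial>lborel \<partial>lborel)"
    unfolding interaction_def by (rule push) simp
  also have "\<dots> = (\<integral>\<^sup>+x. \<integral>\<^sup>+y. K (T x - T y) * u (T x) * v (T y) \<partial>lborel \<partial>lborel)"
    by (intro nn_integral_cong push) simp
  finally show ?thesis by (simp add: interaction_def K)
qed

section \<open>Admissibility and energy under changes on null sets\<close>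

lemma admissible_iff:
  "u \<in> admissible M m \<longleftrightarrow> integrable lebesgue u \<and> (AE x in lebesgue. 0 \<le> u x) \<and>
     (AE x in lebesgue. u x \<le> M) \<and> integral\<^sup>L lebesgue u = m"
proof -
  have "esssup lebesgue (\<lambda>x. ereal \<bar>u x\<bar>) \<le> ereal M \<longleftrightarrow> (AE x in lebesgue. u x \<le> M)"
    if int: "integrable lebesgue u" and nn: "AE x in lebesgue. 0 \<le> u x"
  proof
    assume le: "esssup lebesgue (\<lambda>x. ereal \<bar>u x\<bar>) \<le> ereal M"
    from esssup_AE[of "\<lambda>x. ereal \<bar>u x\<bar>" lebesgue] show "AE x in lebesgue. u x \<le> M"
    proof eventually_elim
      case (elim x)
      with le have "ereal \<bar>u x\<bar> \<le> ereal M" by (rule order_trans[rotated])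
      then show ?case by simp
    qed
  next
    assume "AE x in lebesgue. u x \<le> M"
    with nn have "AE x in lebesgue. ereal \<bar>u x\<bar> \<le> ereal M" by eventually_elim simp
    moreover have "(\<lambda>x. ereal \<bar>u x\<bar>) \<in> borel_measurable lebesgue"
      using borel_measurable_integrable[OF int] by measurable
    ultimately show "esssup lebesgue (\<lambda>x. ereal \<bar>u x\<bar>) \<le> ereal M" by (intro esssup_I)
  qed
  then show ?thesis unfolding admissible_def mem_Collect_eq by blast
qed

lemma admissible_borel_iff:
  fixes u :: "real ^ 'n \<Rightarrow> real"
  assumes u: "u \<in> borel_measurable borel" "\<And>x. 0 \<le> u x"
  shows "u \<in> admissible M m \<longleftrightarrow> integrable lborel u \<and> (AE x in lborel. u x \<le> M) \<and> total_mass u = m"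
  using u by (simp add: admissible_iff integrable_completion integral_completion AE_completion_iff total_mass_def)

lemma admissible_cong_AE:
  fixes u v :: "real ^ 'n \<Rightarrow> real"
  assumes u: "u \<in> admissible M m" and v: "v \<in> borel_measurable lebesgue" and eq: "AE x in lebesgue. u x = v x"
  shows "v \<in> admissible M m"
proof -
  have "integrable lebesgue v"
    using u v eq integrable_cong_AE[of u lebesgue v] borel_measurable_integrable by (auto simp: admissible_iff)
  moreover have "integral\<^sup>L lebesgue v = integral\<^sup>L lebesgue u"
    using u v eq integral_cong_AE[of u lebesgue v] borel_measurable_integrable by (auto simp: admissible_iff)
  moreover have "AE x in lebesgue. 0 \<le> v x \<and> v x \<le> M"
  proof -
    have "AE x in lebesgue. 0 \<le> u x" "AE x in lebesgue. u x \<le> M" using u by (auto simp: admissible_iff)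
    with eq show ?thesis by eventually_elim auto
  qed
  ultimately show ?thesis using u by (auto simp: admissible_iff)
qed

text \<open>A null set of exceptional points yields two null strips in the product space, off which
  both factors agree.\<close>

lemma energy_cong_AE:
  fixes u v :: "real ^ 'n \<Rightarrow> real"
  assumes eq: "AE x in lebesgue. u x = v x"
  shows "energy p q u = energy p q v"
proof -
  have "AE x in lborel. u x = v x" using eq by (simp add: AE_completion_iff)
  then obtain N where N: "\<And>x. x \<in> space lborel - N \<Longrightarrow> u x = v x" "N \<in> null_sets lborel"
    by (rule AE_E3) blast
  have null: "N \<times> UNIV \<in> null_sets (lborel \<Otimes>\<^sub>M lborel)" "UNIV \<times> N \<in> null_sets (lborel \<Otimes>\<^sub>M lborel)"
    using N(2) by (auto simp: null_sets_def lborel.emeasure_pair_measure_Times)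
  have "AE z in lborel. z \<notin> N \<times> (UNIV :: (real ^ 'n) set) \<and> z \<notin> (UNIV :: (real ^ 'n) set) \<times> N"
    using AE_not_in[OF null(1)] AE_not_in[OF null(2)] unfolding lborel_prod by eventually_elim simp
  then have "AE z in lborel. u (fst z) = v (fst z) \<and> u (snd z) = v (snd z)"
    by eventually_elim (auto simp: N(1)[simplified] mem_Times_iff)
  then have "AE z in lebesgue. u (fst z) = v (fst z) \<and> u (snd z) = v (snd z)"
    by (simp only: AE_completion_iff)
  then show ?thesis
    unfolding energy_def by (intro nn_integral_cong_AE, eventually_elim) (simp add: case_prod_beta)
qed

text \<open>The interaction kernel as a combination of powers with positive coefficients (for p < 0
  < q), the shape in which the equality case is stated.\<close>

definition energy_kernel :: "real \<Rightarrow> real \<Rightarrow> 'a::euclidean_space \<Rightarrow> ennreal" where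
  "energy_kernel p q z = ennreal (1 / q * norm z powr q + 1 / (- p) * norm z powr p)"

lemma measurable_energy_kernel [measurable]: "energy_kernel p q \<in> borel_measurable borel"
  unfolding energy_kernel_def by measurable

lemma energy_eq_interaction:
  fixes u :: "real ^ 'n \<Rightarrow> real"
  assumes [measurable]: "u \<in> borel_measurable borel" and u: "\<And>x. 0 \<le> u x" and pq: "p < 0" "0 < q"
  shows "energy p q u = interaction (energy_kernel p q) u u"
proof -
  have "energy p q u = (\<integral>\<^sup>+z. energy_kernel p q (fst z - snd z) * ennreal (u (fst z)) * ennreal (u (snd z)) \<partial>lborel)"
    unfolding energy_def nn_integral_completion
  proof (rule nn_integral_cong, clarify)
    fix x y :: "real ^ 'n"
    have "interaction_kernel p q (x - y) = 1 / q * norm (x - y) powr q + 1 / (- p) * norm (x - y) powr p"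
      by (simp add: interaction_kernel_def)
    moreover have "1 / q * norm (x - y) powr q + 1 / (- p) * norm (x - y) powr p \<ge> 0"
      using pq by (intro add_nonneg_nonneg mult_nonneg_nonneg) auto
    ultimately show "ennreal (interaction_kernel p q (x - y) * u x * u y) =
      energy_kernel p q (fst (x, y) - snd (x, y)) * ennreal (u (fst (x, y))) * ennreal (u (snd (x, y)))"
      using u by (simp add: energy_kernel_def ennreal_mult)
  qed
  also have "\<dots> = interaction (energy_kernel p q) u u"
    unfolding interaction_def lborel_prod[symmetric]
    by (subst lborel.nn_integral_fst[symmetric]) auto
  finally show ?thesis .
qed

text \<open>A Borel representative that is nonnegative everywhere lets Tonelli and changes of
  variable run over \<open>lborel\<close>, without exceptional sets for the sign.\<close>

locale borel_minimizer =
  fixes p q M m :: real and u :: "real ^ 'n \<Rightarrow> real"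
  assumes exponents: "p < 0" "2 \<le> q" and mass_pos: "0 < m"
    and measurable [measurable]: "u \<in> borel_measurable borel"
    and nonneg: "0 \<le> u x"
    and minimizer: "is_minimizer p q M m u"
begin

lemma admissible: "integrable lborel u" "AE x in lborel. u x \<le> M" "total_mass u = m"
  using minimizer admissible_borel_iff[OF measurable nonneg] by (auto simp: is_minimizer_def)

lemma energy_eq: "energy p q u = interaction (energy_kernel p q) u u"
  using exponents nonneg by (intro energy_eq_interaction) auto

lemma interaction_finite: "interaction (energy_kernel p q) u u < top"
  using minimizer by (simp add: is_minimizer_def flip: energy_eq)

text \<open>Finite energy makes the inner integral finite for almost every x, and positive mass
  provides such an x with \<open>u x > 0\<close>. Seen from this point the kernel grows at least
  like a power q >= 2 of the distance and so controls |y|^2 up to a constant.\<close>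

lemma finite_second_moment: "finite_second_moment u"
proof
  show "integrable lborel (\<lambda>x. (norm x)\<^sup>2 * u x)"
  proof -
    let ?J = "\<lambda>x. \<integral>\<^sup>+y. energy_kernel p q (x - y) * u x * u y \<partial>lborel"
    have "AE x in lborel. ?J x \<noteq> \<infinity>"
      using interaction_finite unfolding interaction_def
      by (intro nn_integral_PInf_AE) auto
    moreover have "\<not> (AE x in lborel. u x = 0)"
    proof
      assume "AE x in lborel. u x = 0"
      then have "total_mass u = 0" unfolding total_mass_def by (rule integral_eq_zero_AE)
      then show False using admissible(3) mass_pos by simp
    qed
    ultimately obtain x where x: "?J x < top" "u x \<noteq> 0"
      by (metis (mono_tags, lifting) eventually_mono infinity_ennreal_def top.not_eq_extremum)
    then have ux: "u x > 0" using nonneg[of x] by simp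
    \<comment> \<open>The constants come from |y|^2 <= 2 |x|^2 + 2 r^2 and r^2 <= 1 + q k, where r =
      |x - y| and k is the kernel value; dividing by \<open>u x\<close> compensates the factor
      \<open>u x\<close> in the inner integral.\<close>
    define c where "c = 2 * q / u x"
    have c: "c \<ge> 0" using ux exponents by (simp add: c_def)
    define d where "d = 2 * (norm x)\<^sup>2 + 2"
    have d: "d \<ge> 0" by (simp add: d_def)
    have "(\<integral>\<^sup>+y. ennreal ((norm y)\<^sup>2 * u y) \<partial>lborel) \<le>
      (\<integral>\<^sup>+y. ennreal d * ennreal (u y) + ennreal c * (energy_kernel p q (x - y) * u x * u y) \<partial>lborel)"
    proof (rule nn_integral_mono)
      fix y :: "real ^ 'n"
      define r where "r = norm (x - y)"
      define k where "k = 1 / q * r powr q + 1 / (- p) * r powr p"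
      have kernel: "energy_kernel p q (x - y) = ennreal k"
        by (simp only: energy_kernel_def k_def r_def)
      have r: "r \<ge> 0" by (simp add: r_def)
      have k: "1 / q * r powr q \<le> k" using exponents by (simp add: k_def divide_nonneg_nonpos)
      then have k0: "k \<ge> 0" using exponents by (smt (verit) divide_nonneg_nonneg mult_nonneg_nonneg powr_ge_zero)
      have "r\<^sup>2 \<le> 1 + r powr q"
      proof (cases "r \<le> 1")
        case True
        then have "r\<^sup>2 \<le> 1" using r by (simp add: power_le_one)
        then show ?thesis by (simp add: add_increasing2)
      next
        case False
        then have "r powr 2 \<le> r powr q" using exponents by (intro powr_mono) auto
        then show ?thesis using False by (simp add: powr_numeral)
      qed
      also have "r powr q \<le> q * k" using k exponents by (simp add: field_simps)
      finally have "r\<^sup>2 \<le> 1 + q * k" by simp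
      moreover have "(norm y)\<^sup>2 \<le> 2 * (norm x)\<^sup>2 + 2 * r\<^sup>2"
      proof -
        have "norm y \<le> norm x + r" unfolding r_def by (metis norm_triangle_sub norm_minus_commute)
        then have "(norm y)\<^sup>2 \<le> (norm x + r)\<^sup>2" by (intro power_mono) auto
        also have "\<dots> \<le> 2 * (norm x)\<^sup>2 + 2 * r\<^sup>2"
          using zero_le_power2[of "norm x - r"] by (simp add: power2_eq_square algebra_simps del: zero_le_power2)
        finally show ?thesis .
      qed
      ultimately have "(norm y)\<^sup>2 \<le> d + 2 * q * k" by (simp add: d_def algebra_simps)
      then have "(norm y)\<^sup>2 * u y \<le> (d + 2 * q * k) * u y"
        by (intro mult_right_mono nonneg)
      also have "\<dots> = d * u y + c * (k * u x * u y)"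
        using ux by (simp add: c_def field_simps)
      finally have "ennreal ((norm y)\<^sup>2 * u y) \<le> ennreal (d * u y + c * (k * u x * u y))"
        by (rule ennreal_leI)
      also have "\<dots> = ennreal d * ennreal (u y) + ennreal c * (energy_kernel p q (x - y) * u x * u y)"
        unfolding kernel using k0 c d nonneg by (simp add: ennreal_mult)
      finally show "ennreal ((norm y)\<^sup>2 * u y) \<le>
        ennreal d * ennreal (u y) + ennreal c * (energy_kernel p q (x - y) * u x * u y)" .
    qed
    also have "\<dots> = ennreal d * (\<integral>\<^sup>+y. ennreal (u y) \<partial>lborel) + ennreal c * ?J x"
      by (simp add: nn_integral_add nn_integral_cmult)
    also have "\<dots> < top"
      using x(1) integrableD(2)[OF admissible(1)] nonneg
      by (auto simp: ennreal_mult_eq_top_iff less_top[symmetric])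
    finally show ?thesis
      using nonneg by (intro integrableI_nonneg) auto
  qed
qed (use nonneg admissible in auto)

sublocale fsm: finite_second_moment u by (rule finite_second_moment)

lemma borel_minimizer_isometry:
  fixes T :: "real ^ 'n \<Rightarrow> real ^ 'n"
  assumes [measurable]: "T \<in> borel_measurable borel"
    and T: "distr lborel borel T = lborel" and iso: "\<And>x y. norm (T x - T y) = norm (x - y)"
  shows "borel_minimizer p q M m (\<lambda>x. u (T x))"
proof
  have int: "integrable lborel (\<lambda>x. u (T x))"
    using integrable_distr[of T lborel borel u] T admissible(1) by simp
  moreover have "AE x in lborel. u (T x) \<le> M"
    by (rule AE_lborel_compose[OF assms(1) T admissible(2)])
  moreover have "total_mass (\<lambda>x. u (T x)) = m"
    using integral_distr[of T lborel borel u] T admissible(3) by (simp add: total_mass_def)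
  ultimately have "(\<lambda>x. u (T x)) \<in> admissible M m"
    by (subst admissible_borel_iff) (auto simp: nonneg)
  moreover have "energy p q (\<lambda>x. u (T x)) = energy p q u"
    unfolding energy_eq
    by (subst energy_eq_interaction, simp, simp add: nonneg, use exponents in simp, use exponents in simp)
       (rule interaction_isometry[OF _ _ _ _ T], auto simp: energy_kernel_def iso)
  ultimately show "is_minimizer p q M m (\<lambda>x. u (T x))"
    using minimizer by (simp add: is_minimizer_def)
qed (use exponents mass_pos nonneg in auto)

lemma borel_minimizer_translate: "borel_minimizer p q M m (\<lambda>x. u (x - c))"
  by (rule borel_minimizer_isometry[OF _ lborel_distr_minus]) auto

lemma first_moment_translate: "first_moment (\<lambda>x. u (x - c)) = first_moment u + m *\<^sub>R c"
proof -
  have "first_moment (\<lambda>x. u (x - c)) = (\<integral>x. u (x - c) *\<^sub>R x \<partial>distr lborel borel ((+) c))"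
    by (simp add: first_moment_def lborel_distr_plus)
  also have "\<dots> = (\<integral>x. u x *\<^sub>R x + u x *\<^sub>R c \<partial>lborel)"
    by (subst integral_distr) (auto simp: scaleR_add_right add.commute)
  also have "\<dots> = first_moment u + m *\<^sub>R c"
    using fsm.integrable_first admissible by (simp add: first_moment_def total_mass_def)
  finally show ?thesis .
qed

end

lemma borel_minimizer_unique:
  fixes u v :: "real ^ 'n \<Rightarrow> real"
  assumes u: "borel_minimizer p q M m u" and v: "borel_minimizer p q M m v" and q: "q \<le> 4"
    and same: "first_moment u = first_moment v"
  shows "AE x in lborel. u x = v x"
proof -
  interpret u: borel_minimizer p q M m u by fact
  interpret v: borel_minimizer p q M m v by fact
  interpret same_moments u v
    by unfold_locales (simp_all add: same u.admissible v.admissible)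
  let ?K = "energy_kernel p q :: real ^ 'n \<Rightarrow> ennreal"
  define w where "w = (\<lambda>x. (u x + v x) / 2)"
  have w [measurable]: "w \<in> borel_measurable borel" and w_nonneg: "0 \<le> w x" for x
    using u.nonneg[of x] v.nonneg[of x] by (simp_all add: w_def)
  have "w \<in> admissible M m"
  proof (subst admissible_borel_iff[OF w w_nonneg], intro conjI)
    show "integrable lborel w" unfolding w_def using u.admissible v.admissible by auto
    show "AE x in lborel. w x \<le> M"
      using u.admissible(2) v.admissible(2) by eventually_elim (simp add: w_def)
    show "total_mass w = m"
      using u.admissible v.admissible by (simp add: w_def total_mass_def)
  qed
  then have le: "interaction ?K u u \<le> energy p q w" "interaction ?K v v \<le> energy p q w"
    using u.minimizer v.minimizer by (simp_all add: is_minimizer_def u.energy_eq v.energy_eq)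
  have "(\<lambda>x. ennreal (w x)) = (\<lambda>x. (ennreal (u x) + ennreal (v x)) / 2)"
    using u.nonneg v.nonneg by (simp add: w_def divide_ennreal[symmetric] fun_eq_iff)
  then have "4 * energy p q w = interaction ?K u u + 2 * interaction ?K u v + interaction ?K v v"
    using u.exponents w_nonneg
    by (subst energy_eq_interaction[OF w]) (auto intro!: interaction_midpoint simp: energy_kernel_def)
  \<comment> \<open>Both minimality bounds are doubled to match four copies of the midpoint energy;
    afterwards one copy of the finite self-interactions is cancelled.\<close>
  moreover have "2 * interaction ?K u u + 2 * interaction ?K v v \<le> 2 * energy p q w + 2 * energy p q w"
    by (intro add_mono mult_left_mono le) auto
  moreover have "2 * energy p q w + 2 * energy p q w = 4 * energy p q w"
    by (simp add: distrib_right[symmetric])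
  ultimately have "(interaction ?K u u + interaction ?K v v) + (interaction ?K u u + interaction ?K v v) \<le>
    (interaction ?K u u + interaction ?K v v) + 2 * interaction ?K u v"
    by (simp add: mult_2 ac_simps)
  then have "interaction ?K u u + interaction ?K v v \<le> 2 * interaction ?K u v"
    using u.interaction_finite v.interaction_finite by (auto simp: less_top)
  then show ?thesis
    using AE_eq_if_interaction_balanced[OF u.exponents(2) q u.exponents(1), of "1 / q" "1 / (- p)"]
      u.interaction_finite v.interaction_finite u.exponents
    by (simp add: energy_kernel_def[abs_def])
qed

text \<open>A Lebesgue measurable function has a Borel version; clipping it at 0 changes it only on
  a null set, which neither admissibility nor energy notices.\<close>

lemma minimizer_borel_representative:
  fixes u :: "real ^ 'n \<Rightarrow> real"
  assumes u: "is_minimizer p q M m u" and "p < 0" "2 \<le> q" "0 < m"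
  obtains u' where "borel_minimizer p q M m u'" "AE x in lborel. u x = u' x"
proof -
  have adm: "u \<in> admissible M m" using u by (simp add: is_minimizer_def)
  then have "u \<in> borel_measurable lebesgue" "AE x in lborel. 0 \<le> u x"
    by (auto simp: admissible_iff AE_completion_iff)
  moreover obtain f where [measurable]: "f \<in> borel_measurable lborel" and f: "AE x in lborel. u x = f x"
    using completion_ex_borel_measurable_real[OF calculation(1)] by blast
  define u' where "u' = (\<lambda>x. max 0 (f x))"
  have [measurable]: "u' \<in> borel_measurable borel" unfolding u'_def by measurable
  have eq: "AE x in lborel. u x = u' x"
    using f calculation(2) by eventually_elim (simp add: u'_def)
  then have eq': "AE x in lebesgue. u x = u' x" by (simp add: AE_completion_iff)
  have "u' \<in> borel_measurable lebesgue" by (rule measurable_completion) simp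
  then have "u' \<in> admissible M m" "energy p q u = energy p q u'"
    using adm eq' by (auto intro: admissible_cong_AE energy_cong_AE)
  with u have "is_minimizer p q M m u'" by (simp add: is_minimizer_def)
  with assms have "borel_minimizer p q M m u'" by unfold_locales (auto simp: u'_def)
  with eq show thesis using that by blast
qed

theorem theorem1p1:
  fixes p q M m :: real
  assumes "2 \<le> q" and "q \<le> 4"
    and "- real CARD('n::finite) < p" and "p < 0"
    and "0 < M" and "0 < m"
  shows "(\<forall>u v :: real ^ 'n \<Rightarrow> real.
            is_minimizer p q M m u \<and> is_minimizer p q M m v \<longrightarrow>
              (\<exists>c. AE x in lebesgue. v x = u (x - c)))
       \<and> (\<forall>u :: real ^ 'n \<Rightarrow> real.
            is_minimizer p q M m u \<longrightarrow>
              (\<exists>c. radially_symmetric (\<lambda>x. u (x - c))))"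
proof (intro conjI allI impI)
  fix u v :: "real ^ 'n \<Rightarrow> real"
  assume "is_minimizer p q M m u \<and> is_minimizer p q M m v"
  then have u: "is_minimizer p q M m u" and v: "is_minimizer p q M m v" by auto
  from u \<open>p < 0\<close> \<open>2 \<le> q\<close> \<open>0 < m\<close> obtain u'
    where u': "borel_minimizer p q M m u'" "AE x in lborel. u x = u' x"
    by (rule minimizer_borel_representative)
  from v \<open>p < 0\<close> \<open>2 \<le> q\<close> \<open>0 < m\<close> obtain v'
    where v': "borel_minimizer p q M m v'" "AE x in lborel. v x = v' x"
    by (rule minimizer_borel_representative)
  interpret u': borel_minimizer p q M m u' by fact
  \<comment> \<open>First moments are not divided by the mass, so a shift by c moves them by m c;
    this c aligns the two.\<close>
  define c where "c = (first_moment v' - first_moment u') /\<^sub>R m"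
  have "first_moment (\<lambda>x. u' (x - c)) = first_moment v'"
    using \<open>0 < m\<close> by (simp add: u'.first_moment_translate c_def)
  then have "AE x in lborel. u' (x - c) = v' x"
    by (intro borel_minimizer_unique[OF u'.borel_minimizer_translate v'(1) \<open>q \<le> 4\<close>])
  moreover have "AE x in lborel. u (x - c) = u' (x - c)"
    by (rule AE_lborel_compose[OF _ lborel_distr_minus u'(2)]) simp
  ultimately have "AE x in lborel. v x = u (x - c)"
    using v'(2) by eventually_elim simp
  then show "\<exists>c. AE x in lebesgue. v x = u (x - c)" by (auto simp: AE_completion_iff)
next
  fix u :: "real ^ 'n \<Rightarrow> real"
  assume "is_minimizer p q M m u"
  from this \<open>p < 0\<close> \<open>2 \<le> q\<close> \<open>0 < m\<close> obtain u'
    where u': "borel_minimizer p q M m u'" "AE x in lborel. u x = u' x"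
    by (rule minimizer_borel_representative)
  interpret u': borel_minimizer p q M m u' by fact
  \<comment> \<open>This shift moves the centre of mass to the origin, the point fixed by all
    orthogonal maps.\<close>
  define c where "c = - (first_moment u' /\<^sub>R m)"
  define w where "w = (\<lambda>x. u' (x - c))"
  interpret w: borel_minimizer p q M m w
    unfolding w_def by (rule u'.borel_minimizer_translate)
  have w0: "first_moment w = 0"
    unfolding w_def u'.first_moment_translate using \<open>0 < m\<close> by (simp add: c_def)
  have uw: "AE x in lborel. u (x - c) = w x"
    unfolding w_def by (rule AE_lborel_compose[OF _ lborel_distr_minus u'(2)]) simp
  have "AE x in lborel. u (C *v x - c) = u (x - c)" if C: "orthogonal_matrix C" for C :: "real ^ 'n ^ 'n"
  proof -
    have T: "orthogonal_transformation ((*v) C)"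
      using C by (simp add: orthogonal_transformation_matrix)
    then have lin: "linear ((*v) C)" and norm: "\<And>x. norm (C *v x) = norm x"
      by (auto simp: orthogonal_transformation)
    have [measurable]: "(*v) C \<in> borel_measurable borel"
      by (intro borel_measurable_continuous_onI linear_continuous_on linear_linear[THEN iffD2] lin)
    note distr = lborel_distr_orthogonal[OF T]
    interpret wC: borel_minimizer p q M m "\<lambda>x. w (C *v x)"
      by (rule w.borel_minimizer_isometry[OF _ distr])
         (auto simp: norm matrix_vector_mult_diff_distrib[symmetric])
    \<comment> \<open>C maps the first moment of w composed with C to that of w, namely 0; since C
      preserves norms, the former vanishes as well.\<close>
    have "C *v first_moment (\<lambda>x. w (C *v x)) = (\<integral>x. C *v (w (C *v x) *\<^sub>R x) \<partial>lborel)"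
      unfolding first_moment_def
      by (rule integral_bounded_linear[symmetric, OF linear_linear[THEN iffD2, OF lin] wC.fsm.integrable_first])
    also have "\<dots> = (\<integral>x. w x *\<^sub>R x \<partial>distr lborel borel ((*v) C))"
      by (subst integral_distr) (auto simp: matrix_vector_mult_scaleR)
    also have "\<dots> = 0" using w0 by (simp add: distr first_moment_def)
    finally have "first_moment (\<lambda>x. w (C *v x)) = 0" by (metis norm norm_eq_zero)
    then have "AE x in lborel. w (C *v x) = w x"
      using w0 by (intro borel_minimizer_unique[OF wC.borel_minimizer_axioms w.borel_minimizer_axioms \<open>q \<le> 4\<close>]) simp
    moreover have "AE x in lborel. u (C *v x - c) = w (C *v x)"
      by (rule AE_lborel_compose[OF _ distr uw]) simp
    ultimately show ?thesis using uw by eventually_elim simp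
  qed
  then show "\<exists>c. radially_symmetric (\<lambda>x. u (x - c))"
    by (auto simp: radially_symmetric_def AE_completion_iff)
qed

end
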